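(* Let $\|\cdot\|$ be a norm on $\mathbb{R}^n$, let $F:\mathbb{R}^n\to\mathbb{R}^n$ be Lipschitz continuous with constant $\ell$ with respect to $\|\cdot\|$, let $x^0\in\mathbb{R}^n$ be arbitrary, and consider the forward step iteration $x^{k+1}=x^k-\alpha F(x^k)$ with $\alpha>0$. (i) If $F$ is strongly monotone with respect to $\|\cdot\|$ with monotonicity parameter $c>0$, then for every $\alpha\in]0,\alpha^*[$ the iteration converges to the unique zero $x^*$ of $F$, and for every $k\ge0$, $\|x^{k+1}-x^*\|\le(e^{-\alpha c}+e^{\alpha\ell}-1-\alpha\ell)\|x^k-x^*\|$, where $\alpha^*$ is the unique positive value satisfying $e^{-\alpha^*c}+e^{\alpha^*\ell}=2+\alpha^*\ell$. (ii) If $\|\cdot\|$ is a diagonally weighted $\ell_1$ or $\ell_\infty$ norm and $F$ is strongly monotone with respect to $\|\cdot\|$ with monotonicity parameter $c>0$, then for every $\alpha\in]0,1/\mathrm{diagL}(F)]$ the iteration converges to the unique zero $x^*$ of $F$, and for every $k\ge0$, $\|x^{k+1}-x^*\|\le(1-\alpha c)\|x^k-x^*\|$; the contraction factor $1-\alpha c$ over this range is minimized at $\alpha=1/\mathrm{diagL}(F)$. (iii) If $\|\cdot\|$ is a diagonally weighted $\ell_1$ or $\ell_\infty$ norm, $F$ is monotone with respect to $\|\cdot\|$, and $\{x: F(x)=0\}\neq\emptyset$, then for every $\alpha\in]0,1/\mathrm{diagL}(F)[$ the iteration converges to a zero of $F$.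
   Context: A weak pairing (WP) on $\mathbb{R}^n$ is a map $[\![\cdot,\cdot]\!]:\mathbb{R}^n\times\mathbb{R}^n\to\mathbb{R}$ that is subadditive and continuous in its first argument, satisfies $[\![\alpha x,y]\!]=[\![x,\alpha y]\!]=\alpha[\![x,y]\!]$ for $\alpha\ge0$ and $[\![-x,-y]\!]=[\![x,y]\!]$, $[\![x,x]\!]>0$ for $x\ne0$, and $|[\![x,y]\!]|\le[\![x,x]\!]^{1/2}[\![y,y]\!]^{1/2}$. It is compatible with a norm if $[\![x,x]\!]=\|x\|^2$. WPs are assumed to also satisfy Deimling's inequality $[\![x,y]\!]\le\|y\|\lim_{h\to0^+}h^{-1}(\|y+hx\|-\|y\|)$ and the curve norm derivative formula ($\|x(t)\|D^+\|x(t)\|=[\![\dot x(t),x(t)]\!]$ a.e. for differentiable curves). $F$ is monotone with monotonicity parameter $c\ge0$ w.r.t. $\|\cdot\|$ if for some compatible WP, $-[\![-(F(x)-F(y)),x-y]\!]\ge c\|x-y\|^2$ for all $x,y$ (monotone: $c=0$; strongly monotone: $c>0$). $F$ is Lipschitz with constant $\ell$ if $\|F(x)-F(y)\|\le\ell\|x-y\|$ for all $x,y$. For $\eta\in\mathbb{R}^n_{>0}$, the diagonally weighted norms are $\|x\|_{1,[\eta]}=\sum_i\eta_i|x_i|$ and $\|x\|_{\infty,[\eta]^{-1}}=\max_i|x_i|/\eta_i$. For Lipschitz $F$, $\mathrm{diagL}(F):=\sup_{x\in\mathbb{R}^n\setminus\Omega_F}\max_{i}(DF(x))_{ii}$, where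 $\Omega_F$ is the (measure-zero) set where $F$ is not differentiable and $DF$ is the Jacobian. *)

theory Defs
  imports "HOL-Analysis.Analysis"
begin

definition is_norm :: "(real^'n \<Rightarrow> real) \<Rightarrow> bool" where
  "is_norm N \<longleftrightarrow>
     (\<forall>x. N x \<ge> 0) \<and> (\<forall>x. N x = 0 \<longleftrightarrow> x = 0) \<and>
     (\<forall>a x. N (a *\<^sub>R x) = \<bar>a\<bar> * N x) \<and> (\<forall>x y. N (x + y) \<le> N x + N y)"

definition weak_pairing :: "(real^'n \<Rightarrow> real^'n \<Rightarrow> real) \<Rightarrow> bool" where
  "weak_pairing WP \<longleftrightarrow>
     (\<forall>x1 x2 y. WP (x1 + x2) y \<le> WP x1 y + WP x2 y) \<and>
     (\<forall>y. continuous_on UNIV (\<lambda>x. WP x y)) \<and>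
     (\<forall>a x y. a \<ge> 0 \<longrightarrow> WP (a *\<^sub>R x) y = a * WP x y \<and> WP x (a *\<^sub>R y) = a * WP x y) \<and>
     (\<forall>x y. WP (- x) (- y) = WP x y) \<and>
     (\<forall>x. x \<noteq> 0 \<longrightarrow> WP x x > 0) \<and>
     (\<forall>x y. \<bar>WP x y\<bar> \<le> sqrt (WP x x) * sqrt (WP y y))"

definition wp_compatible :: "(real^'n \<Rightarrow> real^'n \<Rightarrow> real) \<Rightarrow> (real^'n \<Rightarrow> real) \<Rightarrow> bool" where
  "wp_compatible WP N \<longleftrightarrow> (\<forall>x. WP x x = (N x)\<^sup>2)"

definition deimling :: "(real^'n \<Rightarrow> real^'n \<Rightarrow> real) \<Rightarrow> (real^'n \<Rightarrow> real) \<Rightarrow> bool" where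
  "deimling WP N \<longleftrightarrow>
     (\<forall>x y L. ((\<lambda>h. (N (y + h *\<^sub>R x) - N y) / h) \<longlongrightarrow> L) (at_right 0) \<longrightarrow> WP x y \<le> N y * L)"

definition upper_dini :: "(real \<Rightarrow> real) \<Rightarrow> real \<Rightarrow> ereal" where
  "upper_dini g t = Limsup (at_right 0) (\<lambda>h. ereal ((g (t + h) - g t) / h))"

definition curve_norm_formula :: "(real^'n \<Rightarrow> real^'n \<Rightarrow> real) \<Rightarrow> (real^'n \<Rightarrow> real) \<Rightarrow> bool" where
  "curve_norm_formula WP N \<longleftrightarrow>
     (\<forall>(x :: real \<Rightarrow> real^'n) x'. (\<forall>t. (x has_vector_derivative x' t) (at t)) \<longrightarrow>
        (AE t in lborel. ereal (N (x t)) * upper_dini (\<lambda>s. N (x s)) t = ereal (WP (x' t) (x t))))"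

definition monotone_param :: "(real^'n \<Rightarrow> real^'n) \<Rightarrow> (real^'n \<Rightarrow> real) \<Rightarrow> real \<Rightarrow> bool" where
  "monotone_param F N c \<longleftrightarrow> c \<ge> 0 \<and>
     (\<exists>WP. weak_pairing WP \<and> wp_compatible WP N \<and> deimling WP N \<and> curve_norm_formula WP N \<and>
        (\<forall>x y. - WP (- (F x - F y)) (x - y) \<ge> c * (N (x - y))\<^sup>2))"

definition lipschitz_wrt :: "(real^'n \<Rightarrow> real^'n) \<Rightarrow> (real^'n \<Rightarrow> real) \<Rightarrow> real \<Rightarrow> bool" where
  "lipschitz_wrt F N l \<longleftrightarrow> (\<forall>x y. N (F x - F y) \<le> l * N (x - y))"

definition wl1_norm :: "real^'n \<Rightarrow> real^'n \<Rightarrow> real" where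
  "wl1_norm \<eta> x = (\<Sum>i\<in>UNIV. \<eta> $ i * \<bar>x $ i\<bar>)"

definition wlinf_norm :: "real^'n \<Rightarrow> real^'n \<Rightarrow> real" where
  "wlinf_norm \<eta> x = Max (range (\<lambda>i. \<bar>x $ i\<bar> / \<eta> $ i))"

definition diag_weighted_l1_or_linf :: "(real^'n \<Rightarrow> real) \<Rightarrow> bool" where
  "diag_weighted_l1_or_linf N \<longleftrightarrow>
     (\<exists>\<eta>. (\<forall>i. \<eta> $ i > 0) \<and> (N = wl1_norm \<eta> \<or> N = wlinf_norm \<eta>))"

definition diagL :: "(real^'n \<Rightarrow> real^'n) \<Rightarrow> real" where
  "diagL F = (SUP x\<in>{x. F differentiable (at x)}.
                Max (range (\<lambda>i. (frechet_derivative F (at x) (axis i 1)) $ i)))"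

definition fwd_iter :: "(real^'n \<Rightarrow> real^'n) \<Rightarrow> real \<Rightarrow> real^'n \<Rightarrow> nat \<Rightarrow> real^'n" where
  "fwd_iter F \<alpha> x0 k = ((\<lambda>x. x - \<alpha> *\<^sub>R F x) ^^ k) x0"

end

theory Submission
  imports Defs
begin

text \<open>Rademacher's theorem, combined with Fubini, bounds the Lipschitz constant of the forward step \<open>I - \<alpha> F\<close>
  by bounds on its derivatives \<open>I - \<alpha> A\<close>. Along the straight curve \<open>t \<mapsto> x - y - t (F x - F y)\<close> the curve norm
  derivative formula and convexity of the norm turn monotonicity into
  \<open>(1 + c t) N (h - t A h) \<le> (1 + l\<^sup>2 t\<^sup>2) N h\<close> for all \<open>t \<ge> 0\<close>. Iterating this with step \<open>\<alpha> / m\<close> and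
  expanding \<open>(I - (\<alpha> / m) A)\<^sup>m\<close> yields (i) as \<open>m\<close> tends to infinity. For weighted \<open>\<ell>\<close>1 and \<open>\<ell>\<close>-infinity norms the case of
  small \<open>t\<close> is a statement on column and row sums that persists as long as \<open>1 - \<alpha> A\<^sub>i\<^sub>i \<ge> 0\<close>, which yields (ii). In (iii) the
  step is a strict average of the identity and a nonexpansive map, so the Krasnoselskii-Mann theorem applies.\<close>

section \<open>Lebesgue density\<close>

text \<open>Two obstacles shape the proof. First, \<open>diagL\<close> sees \<open>F\<close> only
  where it is differentiable, and the segment between two given points may lie entirely in the null
  set of bad points. Bounds are therefore proved along almost every parallel segment, and closedness
  of a non-strict inequality between continuous functions carries them to the given one. Second, the
  weak pairing is accessible only through curves. Along a straight curve the velocity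
  \<open>- (F x - F y)\<close> is frozen, while monotonicity at the moved point \<open>x'\<close>
  speaks of \<open>F x' - F y\<close>; the exchange costs \<open>l * (l * t)\<close>, which is where
  \<open>l\<^sup>2 * t\<^sup>2\<close> comes from. Being of second order, this error vanishes when a
  step is cut into \<open>m\<close> pieces, and also when only terms linear in \<open>t\<close> are
  compared. Cutting needs linearity, so it is done for a derivative \<open>A\<close> and not for
  \<open>F\<close>. In (i), \<open>exp (- \<alpha> * c)\<close> bounds the limit of
  \<open>(I - (\<alpha> / m) A)^m\<close>, that is the semigroup generated by \<open>- A\<close> at
  time \<alpha>, and \<open>exp (\<alpha> * l) - 1 - \<alpha> * l\<close> is the exponential series
  from order two on.\<close>

text \<open>Vitali's theorem exhausts \<open>S\<close>, up to a null set, by disjoint balls inside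
  an open \<open>U\<close> that is larger than \<open>S\<close> by at most \<open>e\<close>. Each
  ball gives \<open>S\<close> at most the share \<theta>, so
  \<open>m \<le> \<theta> * (m + e)\<close> for every \<open>e > 0\<close>. Boundedness makes
  \<open>m\<close> finite, which forces \<open>m = 0\<close>.\<close>

lemma null_sets_if_small_density_bounded:
  fixes S :: "'a::euclidean_space set" and \<theta> :: real
  assumes S: "S \<in> sets borel" and bdd: "bounded S" and \<theta>: "0 \<le> \<theta>" "\<theta> < 1"
    and small: "\<And>x d. x \<in> S \<Longrightarrow> 0 < d \<Longrightarrow> \<exists>a r. 0 < r \<and> r < d \<and> x \<in> cball a r \<and>
      emeasure lborel (S \<inter> cball a r) \<le> ennreal \<theta> * emeasure lborel (cball a r)"
  shows "S \<in> null_sets lborel"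
proof -
  define m where "m = measure lborel S"
  have fin: "emeasure lborel S < \<infinity>"
    using bdd by (rule emeasure_bounded_finite)
  have m: "emeasure lborel S = ennreal m"
    using fin unfolding m_def by (simp add: emeasure_eq_ennreal_measure)
  have m0: "m \<ge> 0" by (simp add: m_def)
  have key: "m \<le> \<theta> * (m + e)" if "e > 0" for e :: real
  proof -
    obtain U where U: "open U" "S \<subseteq> U" "emeasure lborel (U - S) < ennreal e"
      using outer_regular_lborel[OF S \<open>e > 0\<close>] by blast
    define K where "K = {(a, r). 0 < r \<and> cball a r \<subseteq> U \<and>
       emeasure lborel (S \<inter> cball a r) \<le> ennreal \<theta> * emeasure lborel (cball a r)}"
    have cov: "\<exists>i. i \<in> K \<and> x \<in> cball (fst i) (snd i) \<and> snd i < d" if x: "x \<in> S" and d: "0 < d" for x d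
    proof -
      obtain \<delta> where \<delta>: "\<delta> > 0" "ball x \<delta> \<subseteq> U"
        using U x open_contains_ball by blast
      \<comment> \<open>A ball of radius \<open>r\<close> that contains \<open>x\<close> stays
        within \<open>2 * r\<close> of \<open>x\<close>; the bound \<open>\<delta>/2\<close> keeps
        it inside \<open>U\<close>.\<close>
      obtain a r where ar: "0 < r" "r < min d (\<delta>/2)" "x \<in> cball a r"
        "emeasure lborel (S \<inter> cball a r) \<le> ennreal \<theta> * emeasure lborel (cball a r)"
        using small[OF x, of "min d (\<delta>/2)"] d \<delta> by auto
      have "cball a r \<subseteq> ball x \<delta>"
      proof
        fix y assume "y \<in> cball a r"
        then have "dist x y \<le> 2 * r"
          using ar(3) dist_triangle2[of x y a] by (simp add: dist_commute)
        then show "y \<in> ball x \<delta>" using ar by simp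
      qed
      then have "(a, r) \<in> K" using ar \<delta> by (auto simp: K_def)
      with ar show ?thesis by force
    qed
    have pos: "0 < snd i" if "i \<in> K" for i using that by (auto simp: K_def)
    obtain C where C: "countable C" "C \<subseteq> K"
       "pairwise (\<lambda>i j. disjnt (cball (fst i) (snd i)) (cball (fst j) (snd j))) C"
       "negligible (S - (\<Union>i \<in> C. cball (fst i) (snd i)))"
      by (rule Vitali_covering_theorem_cballs[OF pos cov])
    have disj: "disjoint_family_on (\<lambda>i. cball (fst i) (snd i)) C"
      using C(3) unfolding disjoint_family_on_def pairwise_def disjnt_def by blast
    have disjS: "disjoint_family_on (\<lambda>i. S \<inter> cball (fst i) (snd i)) C"
      using disj unfolding disjoint_family_on_def by blast
    define V where "V = (\<Union>i \<in> C. cball (fst i) (snd i))"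
    have Vm: "V \<in> sets borel" unfolding V_def using C(1) by (intro sets.countable_UN') auto
    have "S - V \<in> null_sets lborel"
      using C(4) S Vm null_sets_completion_iff[of "S - V" lborel]
      by (auto simp: V_def negligible_iff_null_sets)
    then have "emeasure lborel S = emeasure lborel (S \<inter> V)"
      using emeasure_Diff_null_set[of "S - V" lborel S] S Vm
      by (simp add: Diff_Diff_Int)
    also have "S \<inter> V = (\<Union>i \<in> C. S \<inter> cball (fst i) (snd i))" by (auto simp: V_def)
    also have "emeasure lborel \<dots> = (\<integral>\<^sup>+i. emeasure lborel (S \<inter> cball (fst i) (snd i)) \<partial>count_space C)"
      using C(1) disjS S by (intro emeasure_UN_countable) auto
    also have "\<dots> \<le> (\<integral>\<^sup>+i. ennreal \<theta> * emeasure lborel (cball (fst i) (snd i)) \<partial>count_space C)"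
      using C(2) by (intro nn_integral_mono) (auto simp: K_def)
    also have "\<dots> = ennreal \<theta> * (\<integral>\<^sup>+i. emeasure lborel (cball (fst i) (snd i)) \<partial>count_space C)"
      by (intro nn_integral_cmult) auto
    also have "(\<integral>\<^sup>+i. emeasure lborel (cball (fst i) (snd i)) \<partial>count_space C) = emeasure lborel V"
      unfolding V_def using C(1) disj by (intro emeasure_UN_countable[symmetric]) auto
    also have "emeasure lborel V \<le> emeasure lborel U"
    proof (rule emeasure_mono)
      have "cball (fst i) (snd i) \<subseteq> U" if "i \<in> C" for i
        using subsetD[OF C(2) that] by (auto simp: K_def)
      then show "V \<subseteq> U" unfolding V_def by (rule UN_least)
    qed (use U(1) in auto)
    also have "emeasure lborel U = emeasure lborel S + emeasure lborel (U - S)"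
      using U S by (subst plus_emeasure) (auto simp: Un_absorb1)
    also have "\<dots> \<le> ennreal m + ennreal e"
      using U(3) by (simp add: m add_mono)
    finally have "ennreal m \<le> ennreal \<theta> * (ennreal m + ennreal e)"
      by (simp add: m mult_left_mono)
    then have "ennreal m \<le> ennreal (\<theta> * (m + e))"
      using m0 \<theta> that by (simp add: ennreal_mult' flip: ennreal_plus)
    then show ?thesis
      using m0 \<theta> that by (subst (asm) ennreal_le_iff) auto
  qed
  have "m = 0"
  proof (rule ccontr)
    assume "m \<noteq> 0"
    then have "m > 0" using m0 by simp
    define t where "t = \<theta> * m"
    have t: "t < m" using \<theta> \<open>m > 0\<close> by (simp add: t_def)
    \<comment> \<open>With this \<open>e\<close> the bound \<open>m \<le> t + e\<close> would place
      \<open>m\<close> at or below the midpoint of \<open>t\<close> and \<open>m\<close>.\<close>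
    define e where "e = (m - t) / 2"
    have e: "e > 0" using t by (simp add: e_def)
    have "\<theta> * e \<le> e" using e \<theta> by (simp add: mult_left_le_one_le)
    then have "m \<le> t + e" using key[OF e] by (simp add: distrib_left t_def)
    then show False using e t unfolding e_def by argo
  qed
  then show ?thesis using m S by (auto simp: null_sets_def)
qed

lemma null_sets_if_small_density:
  fixes S :: "'a::euclidean_space set" and \<theta> :: real
  assumes S: "S \<in> sets borel" and \<theta>: "0 \<le> \<theta>" "\<theta> < 1"
    and small: "\<And>x d. x \<in> S \<Longrightarrow> 0 < d \<Longrightarrow> \<exists>a r. 0 < r \<and> r < d \<and> x \<in> cball a r \<and>
      emeasure lborel (S \<inter> cball a r) \<le> ennreal \<theta> * emeasure lborel (cball a r)"
  shows "S \<in> null_sets lborel"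
proof -
  have "S \<inter> ball 0 (real n) \<in> null_sets lborel" for n
  proof (rule null_sets_if_small_density_bounded[OF _ _ \<theta>])
    fix x :: 'a and d :: real assume "x \<in> S \<inter> ball 0 (real n)" "0 < d"
    then obtain a r where ar: "0 < r" "r < d" "x \<in> cball a r"
      "emeasure lborel (S \<inter> cball a r) \<le> ennreal \<theta> * emeasure lborel (cball a r)"
      using small by blast
    have "emeasure lborel (S \<inter> ball 0 (real n) \<inter> cball a r) \<le> emeasure lborel (S \<inter> cball a r)"
      using S by (intro emeasure_mono) auto
    with ar show "\<exists>a r. 0 < r \<and> r < d \<and> x \<in> cball a r \<and>
      emeasure lborel (S \<inter> ball 0 (real n) \<inter> cball a r) \<le> ennreal \<theta> * emeasure lborel (cball a r)"
      by (meson order_trans)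
  qed (use S in auto)
  then have "(\<Union>n. S \<inter> ball 0 (real n)) \<in> null_sets lborel" by (intro null_sets_UN) auto
  moreover have "(\<Union>n. S \<inter> ball 0 (real n)) = S"
    using reals_Archimedean2 by auto
  ultimately show ?thesis by simp
qed

text \<open>Where the closed set \<open>K\<close> fails to be almost dense at arbitrarily small scales, it misses a fixed
  proportion of small balls.\<close>

lemma AE_closed_almost_dense:
  fixes K :: "'a::euclidean_space set"
  assumes K: "closed K" and \<eta>: "\<eta> > 0"
  shows "AE x in lborel. x \<in> K \<longrightarrow>
    (\<exists>d>0. \<forall>r. 0 < r \<and> r < d \<longrightarrow> (\<forall>y \<in> ball x r. ball y (\<eta> * r) \<inter> K \<noteq> {}))"
proof -
  \<comment> \<open>Points that see a hole of \<open>K\<close> of relative size \<eta> at some scale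
    below \<open>1 / (m + 1)\<close>. Letting the centre \<open>x\<close> vary around a fixed hole
    shows that \<open>P m\<close> is open, so the exceptional set below is Borel.\<close>
  define P where "P m = {x. \<exists>r y. 0 < r \<and> r < inverse (real (Suc m)) \<and> y \<in> ball x r \<and> ball y (\<eta> * r) \<inter> K = {}}" for m
  have opP: "open (P m)" for m
  proof -
    have "P m = (\<Union>(r, y) \<in> {(r, y). 0 < r \<and> r < inverse (real (Suc m)) \<and> ball y (\<eta> * r) \<inter> K = {}}. ball y r)"
      unfolding P_def by (auto simp: dist_commute) blast
    then show ?thesis by (auto intro!: open_Union)
  qed
  define S where "S = K \<inter> (\<Inter>m. P m)"
  have Sm: "S \<in> sets borel"
    unfolding S_def using opP K by (intro sets.Int sets.countable_INT) (auto intro: borel_closed borel_open)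
  define n where "n = DIM('a)"
  \<comment> \<open>The hole \<open>ball y (\<eta> * r)\<close> lies in
    \<open>cball x ((1 + \<eta>) * r)\<close>, and \<open>(\<eta> / (1 + \<eta>)) ^ n\<close> is its
    share of the volume.\<close>
  define \<theta> where "\<theta> = 1 - (\<eta> / (1 + \<eta>)) ^ n"
  have q: "0 < \<eta> / (1 + \<eta>)" "\<eta> / (1 + \<eta>) < 1" using \<eta> by auto
  have \<theta>: "0 \<le> \<theta>" "\<theta> < 1"
    using q zero_less_power[OF q(1), of n] power_le_one[of "\<eta> / (1 + \<eta>)" n] by (auto simp: \<theta>_def)
  have "S \<in> null_sets lborel"
  proof (rule null_sets_if_small_density[OF Sm \<theta>])
    fix x :: 'a and d :: real assume x: "x \<in> S" and d: "0 < d"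
    obtain m where m: "inverse (real (Suc m)) < d / (1 + \<eta>)"
      using reals_Archimedean[of "d / (1 + \<eta>)"] d \<eta> by auto
    obtain r y where ry: "0 < r" "r < inverse (real (Suc m))" "y \<in> ball x r" "ball y (\<eta> * r) \<inter> K = {}"
      using x unfolding S_def P_def by blast
    define R where "R = (1 + \<eta>) * r"
    have "r < d / (1 + \<eta>)" using ry(2) m by (rule order_less_trans)
    then have R: "0 < R" "R < d" using ry(1) \<eta> by (auto simp: R_def field_simps add_pos_pos)
    have sub: "ball y (\<eta> * r) \<subseteq> cball x R"
    proof
      fix z assume "z \<in> ball y (\<eta> * r)"
      then show "z \<in> cball x R"
        using ry dist_triangle[of x z y] by (simp add: R_def algebra_simps)
    qed
    define u where "u = unit_ball_vol (real n)"
    have u: "u \<ge> 0" by (simp add: u_def)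
    have mR: "emeasure lborel (cball x R) = ennreal (u * R ^ n)"
      using emeasure_cball[of R x] R by (simp add: u_def n_def)
    have mr: "emeasure lborel (ball y (\<eta> * r)) = ennreal (u * (\<eta> * r) ^ n)"
      using emeasure_ball[of "\<eta> * r" y] ry \<eta> by (simp add: u_def n_def)
    have "emeasure lborel (S \<inter> cball x R) \<le> emeasure lborel (cball x R - ball y (\<eta> * r))"
      using ry(4) by (intro emeasure_mono) (auto simp: S_def)
    also have "\<dots> = emeasure lborel (cball x R) - emeasure lborel (ball y (\<eta> * r))"
      using sub by (intro emeasure_Diff) (auto simp: mr)
    also have "\<dots> = ennreal (u * R ^ n - u * (\<eta> * r) ^ n)"
      using u ry \<eta> by (simp add: mR mr ennreal_minus)
    also have "u * R ^ n - u * (\<eta> * r) ^ n = \<theta> * (u * R ^ n)"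
    proof -
      have "\<eta> * r = \<eta> / (1 + \<eta>) * R" using \<eta> by (simp add: R_def)
      then have "(\<eta> * r) ^ n = (\<eta> / (1 + \<eta>)) ^ n * R ^ n" by (simp only: power_mult_distrib)
      then show ?thesis unfolding \<theta>_def by (simp only:) (simp add: algebra_simps)
    qed
    also have "ennreal \<dots> = ennreal \<theta> * emeasure lborel (cball x R)"
      using \<theta> by (simp add: mR ennreal_mult')
    finally show "\<exists>a r. 0 < r \<and> r < d \<and> x \<in> cball a r \<and>
      emeasure lborel (S \<inter> cball a r) \<le> ennreal \<theta> * emeasure lborel (cball a r)"
      using R by (intro exI[of _ x] exI[of _ R]) auto
  qed
  then have "AE x in lborel. x \<notin> S" by (rule AE_not_in)
  then show ?thesis
  proof eventually_elim
    case (elim x)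
    show ?case
    proof
      assume "x \<in> K"
      with elim obtain m where "x \<notin> P m" by (auto simp: S_def)
      then show "\<exists>d>0. \<forall>r. 0 < r \<and> r < d \<longrightarrow> (\<forall>y \<in> ball x r. ball y (\<eta> * r) \<inter> K \<noteq> {})"
        by (intro exI[of _ "inverse (real (Suc m))"]) (auto simp: P_def)
    qed
  qed
qed

section \<open>Differentiability of Lipschitz functions on the line\<close>

text \<open>Vitali selects disjoint intervals of slope at least \<open>q\<close> that cover almost
  all of \<open>E\<close> within the open interval. The Stieltjes measure of \<open>f\<close> gives
  each of them at least \<open>q\<close> times its length, and \<open>{a..b}\<close> has total mass
  \<open>f b - f a\<close>. Points of the open interval leave room for short intervals inside
  \<open>{a..b}\<close>.\<close>

lemma mono_slope_measure_bound_greaterThanLessThan: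
  fixes f :: "real \<Rightarrow> real"
  assumes mono: "\<And>x y. x \<le> y \<Longrightarrow> f x \<le> f y" and cont: "continuous_on UNIV f"
    and E: "E \<in> sets borel" and q: "q \<ge> 0" and ab: "a \<le> b"
    and slope: "\<And>x d. x \<in> E \<Longrightarrow> 0 < d \<Longrightarrow>
      \<exists>u v. u < x \<and> x < v \<and> v - u < d \<and> q * (v - u) \<le> f v - f u"
  shows "ennreal q * emeasure lborel (E \<inter> {a<..<b}) \<le> ennreal (f b - f a)"
proof -
  define S where "S = E \<inter> {a<..<b}"
  have S: "S \<in> sets borel" using E by (simp add: S_def)
  define K where "K = {(c::real, r). 0 < r \<and> cball c r \<subseteq> {a..b} \<and> q * (2 * r) \<le> f (c + r) - f (c - r)}"
  have cov: "\<exists>i. i \<in> K \<and> x \<in> cball (fst i) (snd i) \<and> snd i < d" if x: "x \<in> S" and d: "0 < d" for x d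
  proof -
    obtain u v where uv: "u < x" "x < v" "v - u < min (min (x - a) (b - x)) d" "q * (v - u) \<le> f v - f u"
      using slope[of x "min (min (x - a) (b - x)) d"] x d by (auto simp: S_def)
    have "((u + v) / 2, (v - u) / 2) \<in> K"
      using uv by (auto simp: K_def cball_eq_atLeastAtMost field_simps)
    moreover have "x \<in> cball ((u + v) / 2) ((v - u) / 2)"
      using uv by (auto simp: cball_eq_atLeastAtMost field_simps)
    moreover have "(v - u) / 2 < d" using uv by (simp add: field_simps)
    ultimately show ?thesis by force
  qed
  have pos: "0 < snd i" if "i \<in> K" for i using that by (auto simp: K_def)
  obtain C where C: "countable C" "C \<subseteq> K"
     "pairwise (\<lambda>i j. disjnt (cball (fst i) (snd i)) (cball (fst j) (snd j))) C"
     "negligible (S - (\<Union>i \<in> C. cball (fst i) (snd i)))"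
    by (rule Vitali_covering_theorem_cballs[OF pos cov])
  define V where "V = (\<Union>i \<in> C. cball (fst i) (snd i))"
  have Vm: "V \<in> sets borel" unfolding V_def using C(1) by (intro sets.countable_UN') auto
  have disj: "disjoint_family_on (\<lambda>i. cball (fst i) (snd i)) C"
    using C(3) unfolding disjoint_family_on_def pairwise_def disjnt_def by blast
  let ?\<mu> = "interval_measure f"
  have "S - V \<in> null_sets lborel"
    using C(4) S Vm null_sets_completion_iff[of "S - V" lborel]
    by (auto simp: V_def negligible_iff_null_sets)
  then have "emeasure lborel S = emeasure lborel (S \<inter> V)"
    using emeasure_Diff_null_set[of "S - V" lborel S] S Vm by (simp add: Diff_Diff_Int)
  also have "\<dots> \<le> emeasure lborel V"
    using Vm by (intro emeasure_mono) auto
  finally have "ennreal q * emeasure lborel S \<le> ennreal q * emeasure lborel V"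
    by (rule mult_left_mono) simp
  also have "emeasure lborel V = (\<integral>\<^sup>+i. emeasure lborel (cball (fst i) (snd i)) \<partial>count_space C)"
    unfolding V_def using C(1) disj by (intro emeasure_UN_countable) auto
  also have "ennreal q * \<dots> = (\<integral>\<^sup>+i. ennreal q * emeasure lborel (cball (fst i) (snd i)) \<partial>count_space C)"
    by (intro nn_integral_cmult[symmetric]) auto
  also have "\<dots> \<le> (\<integral>\<^sup>+i. emeasure ?\<mu> (cball (fst i) (snd i)) \<partial>count_space C)"
  proof (intro nn_integral_mono)
    fix i assume "i \<in> space (count_space C)"
    then obtain c r where i: "i = (c, r)" "0 < r" "q * (2 * r) \<le> f (c + r) - f (c - r)"
      using C(2) by (auto simp: K_def)
    have "ennreal q * emeasure lborel (cball c r) = ennreal (q * (2 * r))"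
      using i q by (simp add: cball_eq_atLeastAtMost ennreal_mult' flip: ennreal_plus)
    also have "\<dots> \<le> ennreal (f (c + r) - f (c - r))" using i by (intro ennreal_leI)
    also have "\<dots> = emeasure ?\<mu> (cball c r)"
      using i by (simp add: cball_eq_atLeastAtMost emeasure_interval_measure_Icc[OF _ mono cont])
    finally show "ennreal q * emeasure lborel (cball (fst i) (snd i)) \<le> emeasure ?\<mu> (cball (fst i) (snd i))"
      by (simp add: i)
  qed
  also have "\<dots> = emeasure ?\<mu> V"
    unfolding V_def using C(1) disj by (intro emeasure_UN_countable[symmetric]) auto
  also have "\<dots> \<le> emeasure ?\<mu> {a..b}"
  proof (rule emeasure_mono)
    have "cball (fst i) (snd i) \<subseteq> {a..b}" if "i \<in> C" for i
      using subsetD[OF C(2) that] by (auto simp: K_def)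
    then show "V \<subseteq> {a..b}" unfolding V_def by (rule UN_least)
  qed auto
  also have "\<dots> = ennreal (f b - f a)"
    by (rule emeasure_interval_measure_Icc[OF ab mono cont])
  finally show ?thesis by (simp add: S_def)
qed

lemma mono_slope_measure_bound:
  fixes f :: "real \<Rightarrow> real"
  assumes mono: "\<And>x y. x \<le> y \<Longrightarrow> f x \<le> f y" and cont: "continuous_on UNIV f"
    and E: "E \<in> sets borel" and ab: "a \<le> b"
    and slope: "\<And>x d. x \<in> E \<Longrightarrow> 0 < d \<Longrightarrow>
      \<exists>u v. u < x \<and> x < v \<and> v - u < d \<and> q * (v - u) \<le> f v - f u"
  shows "q * measure lborel (E \<inter> {a..b}) \<le> f b - f a"
proof (cases "q \<ge> 0")
  case False
  then have "q * measure lborel (E \<inter> {a..b}) \<le> 0"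
    by (simp add: mult_nonpos_nonneg)
  then show ?thesis using mono[OF ab] by simp
next
  case True
  have fin: "emeasure lborel (E \<inter> {a<..<b}) < \<infinity>"
    by (rule emeasure_bounded_finite) (auto intro: bounded_Int)
  have nul: "{a, b} \<in> null_sets lborel" by (intro finite_imp_null_set_lborel) auto
  have "E \<inter> {a..b} - {a, b} = E \<inter> {a<..<b} - {a, b}" by auto
  then have "measure lborel (E \<inter> {a..b}) = measure lborel (E \<inter> {a<..<b})"
    using E by (metis measure_Diff_null_set[OF _ nul] sets_lborel sets.Int atLeastAtMost_borel greaterThanLessThan_borel)
  moreover have "ennreal (q * measure lborel (E \<inter> {a<..<b})) \<le> ennreal (f b - f a)"
    using mono_slope_measure_bound_greaterThanLessThan[OF mono cont E True ab slope] fin True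
    by (simp add: ennreal_mult' emeasure_eq_ennreal_measure)
  ultimately show ?thesis using mono[OF ab] by (simp add: ennreal_le_iff)
qed

definition steep_set :: "(real \<Rightarrow> real) \<Rightarrow> real \<Rightarrow> real set" where
  "steep_set f q = {x. \<forall>d>0. \<exists>u v. u < x \<and> x < v \<and> v - u < d \<and> q * (v - u) < f v - f u}"

lemma steep_set_borel: "steep_set f q \<in> sets borel"
proof -
  let ?P = "\<lambda>d. \<Union>(u, v) \<in> {(u, v). v - u < d \<and> q * (v - u) < f v - f u}. {u<..<v}"
  have "steep_set f q = (\<Inter>m. ?P (inverse (real (Suc m))))"
  proof (intro equalityI subsetI)
    fix x assume x: "x \<in> steep_set f q"
    show "x \<in> (\<Inter>m. ?P (inverse (real (Suc m))))"
    proof (rule INT_I)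
      fix m
      have "inverse (real (Suc m)) > 0" by simp
      then obtain u v where "u < x" "x < v" "v - u < inverse (real (Suc m))" "q * (v - u) < f v - f u"
        using x unfolding steep_set_def by blast
      then show "x \<in> ?P (inverse (real (Suc m)))" by (intro UN_I[of "(u, v)"]) auto
    qed
  next
    fix x assume x: "x \<in> (\<Inter>m. ?P (inverse (real (Suc m))))"
    show "x \<in> steep_set f q"
      unfolding steep_set_def
    proof (intro CollectI allI impI)
      fix d :: real assume "d > 0"
      then obtain m where m: "inverse (real (Suc m)) < d" using reals_Archimedean by blast
      have "x \<in> ?P (inverse (real (Suc m)))" using x by blast
      then obtain u v where "v - u < inverse (real (Suc m))" "q * (v - u) < f v - f u" "u < x" "x < v"
        by auto
      with m show "\<exists>u v. u < x \<and> x < v \<and> v - u < d \<and> q * (v - u) < f v - f u"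
        by (meson order_less_trans)
    qed
  qed
  moreover have "open (?P d)" for d by (rule open_UN) auto
  then have "(\<Inter>m. ?P (inverse (real (Suc m)))) \<in> sets borel"
    by (intro sets.countable_INT image_subsetI borel_open) auto
  ultimately show ?thesis by simp
qed

text \<open>Both \<open>f x + L * x\<close> and \<open>L * x - f x\<close> are nondecreasing. On a
  set where slopes above \<open>q\<close> and below \<open>p\<close> keep recurring, the measure
  bound applies to the first with \<open>q + L\<close> and to the second with \<open>L - p\<close>.
  Over an interval of length \<open>2 * r\<close> the two increments add up to
  \<open>2 * L * (2 * r)\<close>, so the set fills at most the share
  \<open>2 * L / (2 * L + q - p) < 1\<close> of every interval and has no density point.\<close>

lemma steep_sets_null:
  fixes f :: "real \<Rightarrow> real"
  assumes lip: "\<And>x y. \<bar>f x - f y\<bar> \<le> L * \<bar>x - y\<bar>" and pq: "p < q"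
  shows "steep_set f q \<inter> steep_set (\<lambda>x. - f x) (- p) \<in> null_sets lborel" (is "?E \<in> _")
proof -
  have E: "?E \<in> sets borel" by (intro sets.Int steep_set_borel)
  have L: "L \<ge> 0" using lip[of 0 1] by simp
  have cont: "continuous_on UNIV f"
    unfolding continuous_on_iff
  proof (intro ballI allI impI)
    fix x e :: real assume e: "e > 0"
    show "\<exists>d>0. \<forall>x'\<in>UNIV. dist x' x < d \<longrightarrow> dist (f x') (f x) < e"
    proof (intro exI[of _ "e / (L + 1)"] conjI ballI impI)
      show "e / (L + 1) > 0" using e L by simp
    next
      fix x' assume "dist x' x < e / (L + 1)"
      then have "(L + 1) * \<bar>x' - x\<bar> < e" using L by (simp add: dist_real_def field_simps)
      moreover have "L * \<bar>x' - x\<bar> \<le> (L + 1) * \<bar>x' - x\<bar>" by (intro mult_right_mono) auto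
      ultimately show "dist (f x') (f x) < e" using lip[of x' x] by (simp add: dist_real_def)
    qed
  qed
  define \<theta> where "\<theta> = 2 * L / (2 * L + q - p)"
  have den: "2 * L + q - p > 0" using L pq by simp
  have \<theta>: "0 \<le> \<theta>" "\<theta> < 1" using L pq den by (auto simp: \<theta>_def field_simps)
  show ?thesis
  proof (rule null_sets_if_small_density[OF E \<theta>])
    fix x d :: real assume x: "x \<in> ?E" and d: "0 < d"
    define r where "r = d / 2"
    have r: "0 < r" "r < d" using d by (auto simp: r_def)
    let ?m = "measure lborel (?E \<inter> {x - r..x + r})"
    have "(q + L) * ?m \<le> (f (x + r) + L * (x + r)) - (f (x - r) + L * (x - r))"
    proof (rule mono_slope_measure_bound)
      fix x y :: real assume "x \<le> y"
      then show "f x + L * x \<le> f y + L * y" using lip[of x y] by (simp add: algebra_simps)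
    next
      fix x d :: real assume "x \<in> ?E" "0 < d"
      then obtain u v where "u < x" "x < v" "v - u < d" "q * (v - u) < f v - f u"
        unfolding steep_set_def by blast
      then show "\<exists>u v. u < x \<and> x < v \<and> v - u < d \<and> (q + L) * (v - u) \<le> f v + L * v - (f u + L * u)"
        by (intro exI[of _ u] exI[of _ v]) (auto simp: algebra_simps)
    qed (use E r cont in \<open>auto intro!: continuous_intros\<close>)
    moreover have "(L - p) * ?m \<le> (L * (x + r) - f (x + r)) - (L * (x - r) - f (x - r))"
    proof (rule mono_slope_measure_bound)
      fix x y :: real assume "x \<le> y"
      then show "L * x - f x \<le> L * y - f y" using lip[of x y] by (simp add: algebra_simps)
    next
      fix x d :: real assume "x \<in> ?E" "0 < d"
      then obtain u v where "u < x" "x < v" "v - u < d" "- p * (v - u) < - f v - - f u"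
        unfolding steep_set_def by blast
      then show "\<exists>u v. u < x \<and> x < v \<and> v - u < d \<and> (L - p) * (v - u) \<le> L * v - f v - (L * u - f u)"
        by (intro exI[of _ u] exI[of _ v]) (auto simp: algebra_simps)
    qed (use E r cont in \<open>auto intro!: continuous_intros\<close>)
    ultimately have "(2 * L + q - p) * ?m \<le> 2 * L * (2 * r)" by (simp add: algebra_simps)
    then have m: "?m \<le> \<theta> * (2 * r)" using den by (simp add: \<theta>_def field_simps)
    have "emeasure lborel (?E \<inter> {x - r..x + r}) < \<infinity>"
      by (rule emeasure_bounded_finite) (auto intro: bounded_Int)
    then have "emeasure lborel (?E \<inter> cball x r) = ennreal ?m"
      by (simp add: cball_eq_atLeastAtMost emeasure_eq_ennreal_measure)
    also have "\<dots> \<le> ennreal (\<theta> * (2 * r))" using m by (rule ennreal_leI)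
    also have "\<dots> = ennreal \<theta> * emeasure lborel (cball x r)"
      using \<theta> r by (simp add: cball_eq_atLeastAtMost ennreal_mult' flip: ennreal_plus)
    finally show "\<exists>a r. 0 < r \<and> r < d \<and> x \<in> cball a r \<and>
      emeasure lborel (?E \<inter> cball a r) \<le> ennreal \<theta> * emeasure lborel (cball a r)"
      using r by (intro exI[of _ x] exI[of _ r]) auto
  qed
qed

text \<open>A derivative at \<open>x\<close> compares \<open>x\<close> itself with a neighbour, so
  \<open>x\<close> must be allowed as an end point. Widening the interval to \<open>u - s\<close>
  and \<open>v + s\<close> and letting \<open>s\<close> tend to 0 achieves this by
  continuity.\<close>

lemma not_steep_imp_slope_le:
  fixes f :: "real \<Rightarrow> real"
  assumes cont: "continuous_on UNIV f" and x: "x \<notin> steep_set f q"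
  shows "\<exists>d>0. \<forall>u v. u \<le> x \<and> x \<le> v \<and> v - u < d \<longrightarrow> f v - f u \<le> q * (v - u)"
proof -
  obtain d where d: "d > 0" "\<And>u v. u < x \<Longrightarrow> x < v \<Longrightarrow> v - u < d \<Longrightarrow> f v - f u \<le> q * (v - u)"
    using x unfolding steep_set_def mem_Collect_eq by (meson not_less)
  show ?thesis
  proof (intro exI[of _ d] conjI allI impI)
    fix u v assume uv: "u \<le> x \<and> x \<le> v \<and> v - u < d"
    have ct: "isCont f z" for z using cont by (simp add: continuous_on_eq_continuous_at)
    have lim: "((\<lambda>s. q * ((v + s) - (u - s)) - (f (v + s) - f (u - s))) \<longlongrightarrow>
        q * ((v + 0) - (u - 0)) - (f (v + 0) - f (u - 0))) (at_right 0)"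
      by (intro tendsto_intros isCont_tendsto_compose[OF ct])
    have "\<forall>\<^sub>F s in at_right 0. s < (d - (v - u)) / 2"
      using uv by (intro eventually_at_right_less[THEN eventually_mono] order_tendstoD(2)[OF tendsto_ident_at]) auto
    then have "\<forall>\<^sub>F s in at_right 0. 0 \<le> q * ((v + s) - (u - s)) - (f (v + s) - f (u - s))"
      using eventually_at_right_less[of "0::real"]
    proof eventually_elim
      case (elim s)
      then show ?case using d(2)[of "u - s" "v + s"] uv by (auto simp: field_simps)
    qed
    then have "0 \<le> q * ((v + 0) - (u - 0)) - (f (v + 0) - f (u - 0))"
      by (rule tendsto_lowerbound[OF lim]) simp
    then show "f v - f u \<le> q * (v - u)" by simp
  qed (use d in auto)
qed

text \<open>Outside countably many null sets, one for each rational pair \<open>p < q\<close>,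
  either all short intervals around \<open>x\<close> have slope at most \<open>q\<close> or all have
  slope at least \<open>p\<close>. This leaves no gap between lower and upper slopes.\<close>

theorem lipschitz_real_AE_differentiable:
  fixes f :: "real \<Rightarrow> real"
  assumes lip: "\<And>x y. \<bar>f x - f y\<bar> \<le> L * \<bar>x - y\<bar>"
  shows "AE x in lborel. \<exists>D. (f has_real_derivative D) (at x)"
proof -
  define I where "I = {(p, q). p \<in> \<rat> \<and> q \<in> \<rat> \<and> p < (q::real)}"
  have "countable I"
    by (rule countable_subset[of _ "\<rat> \<times> \<rat>"]) (auto simp: I_def countable_rat)
  moreover have "\<forall>(p, q) \<in> I. AE x in lborel. x \<notin> steep_set f q \<inter> steep_set (\<lambda>x. - f x) (- p)"
    using AE_not_in[OF steep_sets_null[OF lip]] unfolding I_def by blast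
  ultimately have "AE x in lborel. \<forall>(p, q) \<in> I. x \<notin> steep_set f q \<inter> steep_set (\<lambda>x. - f x) (- p)"
    by (subst AE_ball_countable) (auto simp: case_prod_beta)
  then show ?thesis
  proof eventually_elim
    case (elim x)
    have L: "L \<ge> 0" using lip[of 0 1] by simp
    have "L-lipschitz_on UNIV f"
      using lip L by (intro lipschitz_onI) (auto simp: dist_real_def)
    then have cont: "continuous_on UNIV f" by (rule lipschitz_on_continuous_on)
    define lo where "lo p \<longleftrightarrow> (\<exists>d>0. \<forall>u v. u \<le> x \<and> x \<le> v \<and> v - u < d \<longrightarrow> p * (v - u) \<le> f v - f u)" for p
    define up where "up q \<longleftrightarrow> (\<exists>d>0. \<forall>u v. u \<le> x \<and> x \<le> v \<and> v - u < d \<longrightarrow> f v - f u \<le> q * (v - u))" for q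
    have updown: "up q \<or> lo p" if "p \<in> \<rat>" "q \<in> \<rat>" "p < q" for p q
    proof -
      have "x \<notin> steep_set f q \<or> x \<notin> steep_set (\<lambda>x. - f x) (- p)"
        using elim that by (auto simp: I_def)
      then show ?thesis
      proof
        assume "x \<notin> steep_set f q"
        from not_steep_imp_slope_le[OF cont this] show ?thesis by (simp add: up_def)
      next
        assume *: "x \<notin> steep_set (\<lambda>x. - f x) (- p)"
        have "lo p"
          using not_steep_imp_slope_le[OF _ *] cont unfolding lo_def
          by (auto intro!: continuous_intros simp: algebra_simps)
        then show ?thesis ..
      qed
    qed
    \<comment> \<open>The derivative is the largest eventual lower slope; Lipschitz continuity makes
      the set nonempty (\<open>- L\<close> belongs to it) and bounded by \<open>L\<close>.\<close>
    define D where "D = Sup {p. lo p}"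
    have lob: "p \<le> L" if lop: "lo p" for p
    proof -
      obtain d where d: "d > 0" "\<forall>u v. u \<le> x \<and> x \<le> v \<and> v - u < d \<longrightarrow> p * (v - u) \<le> f v - f u"
        using lop by (auto simp: lo_def)
      from d(2)[rule_format, of x "x + d/2"] d(1) have "p * (d/2) \<le> f (x + d/2) - f x" by simp
      also have "\<dots> \<le> \<bar>f (x + d/2) - f x\<bar>" by simp
      also have "\<dots> \<le> L * (d/2)" using lip[of "x + d/2" x] d(1) by simp
      finally show ?thesis using d(1) by simp
    qed
    have loL: "lo (- L)" unfolding lo_def
    proof (intro exI[of _ 1] conjI allI impI)
      fix u v assume "u \<le> x \<and> x \<le> v \<and> v - u < 1"
      then show "- L * (v - u) \<le> f v - f u" using lip[of v u] by auto
    qed simp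
    have bdd: "bdd_above {p. lo p}" using lob by (auto simp: bdd_above_def)
    have low: "lo p" if pD: "p < D" for p
    proof -
      obtain p' where p': "lo p'" "p < p'"
        using less_cSup_iff[of "{p. lo p}" p] bdd loL pD by (auto simp: D_def)
      then obtain d where d: "d > 0" "\<forall>u v. u \<le> x \<and> x \<le> v \<and> v - u < d \<longrightarrow> p' * (v - u) \<le> f v - f u"
        by (auto simp: lo_def)
      show "lo p" unfolding lo_def
      proof (intro exI[of _ d] conjI allI impI d(1))
        fix u v assume uv: "u \<le> x \<and> x \<le> v \<and> v - u < d"
        then have "p * (v - u) \<le> p' * (v - u)" using p' by (intro mult_right_mono) auto
        with d(2) uv show "p * (v - u) \<le> f v - f u" by (meson order_trans)
      qed
    qed
    have upp: "up q" if Dq: "D < q" for q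
    proof -
      \<comment> \<open>Two rationals with \<open>D < p < q' < q\<close> are inserted:
        \<open>p\<close> exceeds \<open>D\<close> and is no lower slope, so the dichotomy makes
        \<open>q'\<close> an upper slope.\<close>
      obtain q' where q': "q' \<in> \<rat>" "D < q'" "q' < q" using Rats_dense_in_real[OF Dq] by blast
      obtain p where p: "p \<in> \<rat>" "D < p" "p < q'" using Rats_dense_in_real[OF q'(2)] by blast
      have "\<not> lo p" using p(2) cSup_upper[OF _ bdd, of p] by (auto simp: D_def)
      then have "up q'" using updown p q' by blast
      then obtain d where d: "d > 0" "\<forall>u v. u \<le> x \<and> x \<le> v \<and> v - u < d \<longrightarrow> f v - f u \<le> q' * (v - u)"
        by (auto simp: up_def)
      show "up q" unfolding up_def
      proof (intro exI[of _ d] conjI allI impI d(1))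
        fix u v assume uv: "u \<le> x \<and> x \<le> v \<and> v - u < d"
        then have "q' * (v - u) \<le> q * (v - u)" using q' by (intro mult_right_mono) auto
        with d(2) uv show "f v - f u \<le> q * (v - u)" by (meson order_trans)
      qed
    qed
    have "(f has_derivative (\<lambda>h. D * h)) (at x)"
      unfolding has_derivative_at_alt
    proof (intro conjI allI impI)
      show "bounded_linear ((*) D)" by (rule bounded_linear_mult_right)
    next
      fix e :: real assume e: "e > 0"
      obtain d1 where d1: "d1 > 0" "\<forall>u v. u \<le> x \<and> x \<le> v \<and> v - u < d1 \<longrightarrow> (D - e) * (v - u) \<le> f v - f u"
        using low[of "D - e"] e by (auto simp: lo_def)
      obtain d2 where d2: "d2 > 0" "\<forall>u v. u \<le> x \<and> x \<le> v \<and> v - u < d2 \<longrightarrow> f v - f u \<le> (D + e) * (v - u)"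
        using upp[of "D + e"] e by (auto simp: up_def)
      show "\<exists>d>0. \<forall>y. norm (y - x) < d \<longrightarrow> norm (f y - f x - D * (y - x)) \<le> e * norm (y - x)"
      proof (intro exI[of _ "min d1 d2"] conjI allI impI)
        fix y assume y: "norm (y - x) < min d1 d2"
        show "norm (f y - f x - D * (y - x)) \<le> e * norm (y - x)"
        proof (cases "x \<le> y")
          case True
          then show ?thesis using d1(2)[rule_format, of x y] d2(2)[rule_format, of x y] y
            by (auto simp: algebra_simps abs_le_iff)
        next
          case False
          then show ?thesis using d1(2)[rule_format, of y x] d2(2)[rule_format, of y x] y
            by (auto simp: algebra_simps abs_le_iff)
        qed
      qed (use d1 d2 in auto)
    qed
    then show ?case unfolding has_field_derivative_def by blast
  qed
qed

section \<open>Rademacher's theorem\<close>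

text \<open>The complement is open and null, hence empty. This turns almost-everywhere inequalities
  between continuous functions into inequalities everywhere.\<close>

lemma mem_closed_if_AE_lborel:
  fixes C :: "'a::euclidean_space set"
  assumes "closed C" "AE x in lborel. x \<in> C"
  shows "x \<in> C"
  using mem_closed_if_AE_lebesgue_open[of UNIV C x] AE_completion[OF assms(2)] assms(1) by simp

text \<open>By Fubini the two quantifiers commute, and for fixed \<open>t\<close> the inner
  statement is about a translate of \<open>E\<close>. Read from left to right it yields null sets
  from their traces on lines; read from right to left it finds lines on which a null set is
  negligible.\<close>

lemma AE_lines_iff:
  fixes E :: "'a::euclidean_space set" and v :: 'a
  assumes E: "E \<in> sets borel"
  shows "(AE z in lborel. AE t::real in lborel. z + t *\<^sub>R v \<notin> E) \<longleftrightarrow> (AE z in lborel. z \<notin> E)"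
proof -
  have meas: "(\<lambda>p. fst p + snd p *\<^sub>R v) \<in> borel_measurable ((lborel :: 'a measure) \<Otimes>\<^sub>M (lborel :: real measure))"
    by measurable
  have "(\<lambda>p. fst p + snd p *\<^sub>R v) -` (- E) \<inter> space ((lborel :: 'a measure) \<Otimes>\<^sub>M (lborel :: real measure))
      \<in> sets ((lborel :: 'a measure) \<Otimes>\<^sub>M (lborel :: real measure))"
    using E by (intro measurable_sets[OF meas]) auto
  also have "(\<lambda>p. fst p + snd p *\<^sub>R v) -` (- E) \<inter> space ((lborel :: 'a measure) \<Otimes>\<^sub>M (lborel :: real measure)) =
      {p \<in> space ((lborel :: 'a measure) \<Otimes>\<^sub>M (lborel :: real measure)). fst p + snd p *\<^sub>R v \<notin> E}"
    by auto
  finally have "(AE z in lborel. AE t::real in lborel. z + t *\<^sub>R v \<notin> E) \<longleftrightarrow>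
      (AE t::real in lborel. AE z in lborel. z + t *\<^sub>R v \<notin> E)"
    by (rule lborel_pair.AE_commute)
  also have "(\<lambda>t. AE z in lborel. z + t *\<^sub>R v \<notin> E) = (\<lambda>t. AE z in lborel. z \<notin> E)"
  proof
    fix t :: real
    have "(AE z in lborel. z \<notin> E) \<longleftrightarrow> (AE z in distr lborel borel ((+) (t *\<^sub>R v)). z \<notin> E)"
      by (subst lborel_distr_plus) (rule refl)
    also have "\<dots> \<longleftrightarrow> (AE z in lborel. t *\<^sub>R v + z \<notin> E)"
      using E by (intro AE_distr_iff) (auto simp: Compl_eq[symmetric])
    finally show "(AE z in lborel. z + t *\<^sub>R v \<notin> E) \<longleftrightarrow> (AE z in lborel. z \<notin> E)"
      by (simp add: add.commute)
  qed
  also have "(AE t::real in lborel. AE z in lborel. z \<notin> E) \<longleftrightarrow> (AE z in lborel. z \<notin> E)"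
    by (auto simp: eventually_const_iff trivial_limit_def[symmetric] ae_filter_eq_bot_iff)
  finally show ?thesis .
qed

text \<open>The functional \<open>q\<close> may change with the accuracy. Two of them that are valid
  at accuracies \<open>\<epsilon> m\<close> and \<open>\<epsilon> k\<close> differ by at most
  \<open>\<epsilon> m + \<epsilon> k\<close>, so they form a Cauchy sequence, and the limit is the
  gradient.\<close>

lemma has_derivative_if_approx_linear:
  fixes f :: "'a::euclidean_space \<Rightarrow> real"
  assumes approx: "\<And>e. e > 0 \<Longrightarrow>
    \<exists>q d. d > 0 \<and> (\<forall>h. norm h < d \<longrightarrow> \<bar>f (x + h) - f x - q \<bullet> h\<bar> \<le> e * norm h)"
  shows "\<exists>g. (f has_derivative (\<lambda>h. g \<bullet> h)) (at x)"
proof -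
  define \<epsilon> where "\<epsilon> m = inverse (real (Suc m))" for m
  have \<epsilon>: "\<epsilon> m > 0" for m by (simp add: \<epsilon>_def)
  obtain q d where qd: "\<And>m. d m > 0"
    "\<And>m h. norm h < d m \<Longrightarrow> \<bar>f (x + h) - f x - q m \<bullet> h\<bar> \<le> \<epsilon> m * norm h"
    using approx[OF \<epsilon>] by metis
  have diff: "norm (q m - q k) \<le> \<epsilon> m + \<epsilon> k" for m k
  proof (cases "q m = q k")
    case True then show ?thesis using \<epsilon>[of m] \<epsilon>[of k] by simp
  next
    case False
    define u where "u = q m - q k"
    have u: "norm u > 0" using False by (simp add: u_def)
    \<comment> \<open>Testing both approximations at a multiple of their difference \<open>u\<close>
      makes the inner product equal to \<open>s * (norm u)\<^sup>2\<close>; the factor is half the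
      smaller radius, rescaled by \<open>norm u\<close>.\<close>
    define s where "s = min (d m) (d k) / 2 / norm u"
    have s: "s > 0" using qd(1)[of m] qd(1)[of k] u by (simp add: s_def)
    have ns: "norm (s *\<^sub>R u) < d m" "norm (s *\<^sub>R u) < d k"
      using qd(1)[of m] qd(1)[of k] u by (auto simp: s_def min_def)
    have "u \<bullet> (s *\<^sub>R u) = (q m \<bullet> (s *\<^sub>R u)) - (q k \<bullet> (s *\<^sub>R u))"
      unfolding u_def by (rule inner_diff_left)
    also have "\<dots> \<le> \<epsilon> m * norm (s *\<^sub>R u) + \<epsilon> k * norm (s *\<^sub>R u)"
      using qd(2)[OF ns(1)] qd(2)[OF ns(2)] by linarith
    finally have "s * (norm u * norm u) \<le> s * ((\<epsilon> m + \<epsilon> k) * norm u)"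
      using s by (simp add: dot_square_norm power2_eq_square algebra_simps)
    then show ?thesis using s u by (simp add: u_def)
  qed
  have lim\<epsilon>: "\<epsilon> \<longlonglongrightarrow> 0"
    unfolding \<epsilon>_def by (rule LIMSEQ_inverse_real_of_nat)
  have "Cauchy q"
  proof (rule metric_CauchyI)
    fix e :: real assume "e > 0"
    then have "\<forall>\<^sub>F m in sequentially. \<epsilon> m < e / 2"
      using lim\<epsilon> by (intro order_tendstoD(2)) auto
    then obtain M where M: "\<And>m. m \<ge> M \<Longrightarrow> \<epsilon> m < e / 2"
      by (auto simp: eventually_sequentially)
    have "dist (q m) (q k) < e" if "m \<ge> M" "k \<ge> M" for m k
      using diff[of m k] M[OF that(1)] M[OF that(2)] by (simp add: dist_norm)
    then show "\<exists>M. \<forall>m\<ge>M. \<forall>n\<ge>M. dist (q m) (q n) < e" by blast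
  qed
  then obtain g where g: "q \<longlonglongrightarrow> g"
    using Cauchy_convergent convergent_def by blast
  have qg: "norm (q m - g) \<le> \<epsilon> m" for m
  proof (rule LIMSEQ_le)
    show "(\<lambda>k. norm (q m - q k)) \<longlonglongrightarrow> norm (q m - g)" by (intro tendsto_intros g)
    show "(\<lambda>k. \<epsilon> m + \<epsilon> k) \<longlonglongrightarrow> \<epsilon> m" using tendsto_add[OF tendsto_const lim\<epsilon>] by simp
  qed (use diff in auto)
  have "(f has_derivative (\<lambda>h. g \<bullet> h)) (at x)"
    unfolding has_derivative_at_alt
  proof (intro conjI allI impI)
    show "bounded_linear ((\<bullet>) g)" by (rule bounded_linear_inner_right)
  next
    fix e :: real assume "e > 0"
    then have "\<forall>\<^sub>F m in sequentially. \<epsilon> m < e / 2"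
      using lim\<epsilon> by (intro order_tendstoD(2)) auto
    then obtain m where m: "\<epsilon> m < e / 2" by (auto simp: eventually_sequentially)
    show "\<exists>d>0. \<forall>y. norm (y - x) < d \<longrightarrow> norm (f y - f x - g \<bullet> (y - x)) \<le> e * norm (y - x)"
    proof (intro exI[of _ "d m"] conjI allI impI qd(1))
      fix y assume "norm (y - x) < d m"
      from qd(2)[OF this] have "\<bar>f y - f x - q m \<bullet> (y - x)\<bar> \<le> \<epsilon> m * norm (y - x)" by simp
      moreover have "\<bar>(q m - g) \<bullet> (y - x)\<bar> \<le> \<epsilon> m * norm (y - x)"
        using Cauchy_Schwarz_ineq2[of "q m - g" "y - x"] mult_right_mono[OF qg[of m] norm_ge_zero[of "y - x"]]
        by linarith
      ultimately have "\<bar>f y - f x - g \<bullet> (y - x)\<bar> \<le> \<epsilon> m * norm (y - x) + \<epsilon> m * norm (y - x)"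
        by (simp add: inner_diff_left)
      also have "\<dots> = (2 * \<epsilon> m) * norm (y - x)" by simp
      also have "\<dots> \<le> e * norm (y - x)" using m by (intro mult_right_mono) auto
      finally show "norm (f y - f x - g \<bullet> (y - x)) \<le> e * norm (y - x)" by simp
    qed
  qed
  then show ?thesis ..
qed

text \<open>One slope \<open>q\<close>, one accuracy \<open>e\<close> and one scale \<open>d\<close>
  serve all points of the set. Without a limit in its description the set is closed for continuous
  \<open>f\<close>, and countably many such sets describe directional differentiability.\<close>

definition diff_quot_set :: "('a::euclidean_space \<Rightarrow> real) \<Rightarrow> 'a \<Rightarrow> real \<Rightarrow> real \<Rightarrow> real \<Rightarrow> 'a set" where
  "diff_quot_set f v q e d = {y. \<forall>s. \<bar>s\<bar> < d \<longrightarrow> \<bar>f (y + s *\<^sub>R v) - f y - q * s\<bar> \<le> e * \<bar>s\<bar>}"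

lemma closed_diff_quot_set:
  assumes cont: "continuous_on UNIV f"
  shows "closed (diff_quot_set f v q e d)"
proof -
  have "continuous_on UNIV (\<lambda>y. f (y + s *\<^sub>R v))" for s
    by (rule continuous_on_compose2[OF cont]) (auto intro!: continuous_intros)
  then have "closed {y. \<bar>s\<bar> < d \<longrightarrow> \<bar>f (y + s *\<^sub>R v) - f y - q * s\<bar> \<le> e * \<bar>s\<bar>}" for s
    by (intro closed_Collect_imp closed_Collect_le continuous_intros cont) auto
  then show ?thesis unfolding diff_quot_set_def by (rule closed_Collect_all)
qed

text \<open>On each line in direction \<open>v\<close> the one-dimensional theorem applies, and
  Fubini assembles the lines. Fubini needs the set of good points to be Borel, which is the purpose
  of rewriting it as \<open>Q\<close>, with rational slopes and scales of the form
  \<open>1 / (k + 1)\<close>.\<close>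

lemma AE_directional_derivative:
  fixes f :: "'a::euclidean_space \<Rightarrow> real"
  assumes lip: "\<And>x y. \<bar>f x - f y\<bar> \<le> L * norm (x - y)" and cont: "continuous_on UNIV f"
  shows "AE y in lborel. \<exists>D. ((\<lambda>s. f (y + s *\<^sub>R v)) has_real_derivative D) (at 0)"
proof -
  define G where "G = {y. \<exists>D. ((\<lambda>s. f (y + s *\<^sub>R v)) has_real_derivative D) (at 0)}"
  define Q where "Q = (\<Inter>m. \<Union>q\<in>\<rat>. \<Union>k. diff_quot_set f v q (inverse (real (Suc m))) (inverse (real (Suc k))))"
  have "G = Q"
  proof (intro equalityI subsetI)
    fix y assume "y \<in> G"
    then obtain D where D: "((\<lambda>s. f (y + s *\<^sub>R v)) has_derivative (\<lambda>h. D * h)) (at 0)"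
      by (auto simp: G_def has_field_derivative_def)
    show "y \<in> Q" unfolding Q_def
    proof (rule INT_I)
      fix m
      define e where "e = inverse (real (Suc m))"
      have e: "e > 0" by (simp add: e_def)
      obtain d where d: "d > 0"
        "\<And>s. norm (s - 0) < d \<Longrightarrow> norm (f (y + s *\<^sub>R v) - f (y + 0 *\<^sub>R v) - D * (s - 0)) \<le> e/2 * norm (s - 0)"
        using D e unfolding has_derivative_at_alt by (meson half_gt_zero)
      obtain q where q: "q \<in> \<rat>" "D < q" "q < D + e/2"
        using Rats_dense_in_real[of D "D + e/2"] e by auto
      obtain k where k: "inverse (real (Suc k)) < d" using reals_Archimedean d(1) by blast
      have "\<bar>f (y + s *\<^sub>R v) - f y - q * s\<bar> \<le> e * \<bar>s\<bar>" if "\<bar>s\<bar> < inverse (real (Suc k))" for s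
      proof -
        have "\<bar>f (y + s *\<^sub>R v) - f y - D * s\<bar> \<le> e/2 * \<bar>s\<bar>" using d(2)[of s] k that by simp
        moreover have "\<bar>(q - D) * s\<bar> \<le> e/2 * \<bar>s\<bar>"
          using q unfolding abs_mult by (intro mult_right_mono) auto
        ultimately have "\<bar>f (y + s *\<^sub>R v) - f y - q * s\<bar> \<le> e/2 * \<bar>s\<bar> + e/2 * \<bar>s\<bar>"
          by (simp only: left_diff_distrib)
        then show ?thesis by (simp add: field_simps)
      qed
      then have "y \<in> diff_quot_set f v q e (inverse (real (Suc k)))" by (simp add: diff_quot_set_def)
      with q(1) show "y \<in> (\<Union>q\<in>\<rat>. \<Union>k. diff_quot_set f v q (inverse (real (Suc m))) (inverse (real (Suc k))))"
        unfolding e_def by blast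
    qed
  next
    fix y assume y: "y \<in> Q"
    have "\<exists>g. ((\<lambda>s. f (y + s *\<^sub>R v)) has_derivative (\<lambda>h. g \<bullet> h)) (at (0::real))"
    proof (rule has_derivative_if_approx_linear)
      fix e :: real assume "e > 0"
      then obtain m where m: "inverse (real (Suc m)) < e" using reals_Archimedean by blast
      from y have "y \<in> (\<Union>q\<in>\<rat>. \<Union>k. diff_quot_set f v q (inverse (real (Suc m))) (inverse (real (Suc k))))"
        unfolding Q_def by (rule INT_D) simp
      then obtain q k where qk: "y \<in> diff_quot_set f v q (inverse (real (Suc m))) (inverse (real (Suc k)))"
        by blast
      show "\<exists>q d. d > 0 \<and> (\<forall>h. norm h < d \<longrightarrow> \<bar>f (y + (0 + h) *\<^sub>R v) - f (y + 0 *\<^sub>R v) - q \<bullet> h\<bar> \<le> e * norm h)"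
      proof (rule exI[of _ q], rule exI[of _ "inverse (real (Suc k))"], intro conjI allI impI)
        fix h :: real assume "norm h < inverse (real (Suc k))"
        then have "\<bar>f (y + h *\<^sub>R v) - f y - q * h\<bar> \<le> inverse (real (Suc m)) * \<bar>h\<bar>"
          using qk by (simp add: diff_quot_set_def)
        also have "\<dots> \<le> e * \<bar>h\<bar>" using m by (intro mult_right_mono) auto
        finally show "\<bar>f (y + (0 + h) *\<^sub>R v) - f (y + 0 *\<^sub>R v) - q \<bullet> h\<bar> \<le> e * norm h" by simp
      qed simp
    qed
    then show "y \<in> G" by (auto simp: G_def has_field_derivative_def)
  qed
  moreover have "Q \<in> sets borel"
    unfolding Q_def
    by (intro sets.countable_INT' sets.countable_UN' image_subsetI borel_closed closed_diff_quot_set cont countable_rat) auto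
  ultimately have G: "- G \<in> sets borel" by auto
  have "AE z in lborel. AE t::real in lborel. z + t *\<^sub>R v \<notin> - G"
  proof (rule AE_I2)
    fix z :: 'a
    have "AE t in lborel. \<exists>D. ((\<lambda>t. f (z + t *\<^sub>R v)) has_real_derivative D) (at t)"
    proof (rule lipschitz_real_AE_differentiable)
      fix x y :: real
      show "\<bar>f (z + x *\<^sub>R v) - f (z + y *\<^sub>R v)\<bar> \<le> (L * norm v) * \<bar>x - y\<bar>"
        using lip[of "z + x *\<^sub>R v" "z + y *\<^sub>R v"] by (simp add: mult_ac flip: scaleR_diff_left)
    qed
    then show "AE t in lborel. z + t *\<^sub>R v \<notin> - G"
    proof eventually_elim
      case (elim t)
      then obtain D where "((\<lambda>t. f (z + t *\<^sub>R v)) has_real_derivative D) (at (0 + t))" by auto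
      then have "((\<lambda>s. f (z + (s + t) *\<^sub>R v)) has_real_derivative D) (at 0)"
        by (subst (asm) DERIV_shift)
      then have "((\<lambda>s. f ((z + t *\<^sub>R v) + s *\<^sub>R v)) has_real_derivative D) (at 0)"
        by (simp add: algebra_simps)
      then show ?case by (auto simp: G_def)
    qed
  qed
  then have "AE z in lborel. z \<notin> - G" using AE_lines_iff[OF G] by blast
  then show ?thesis by (simp add: G_def)
qed

lemma norm_partial_sum_Basis_le:
  fixes h :: "'a::euclidean_space"
  assumes "B \<subseteq> Basis"
  shows "norm (\<Sum>b\<in>B. (h \<bullet> b) *\<^sub>R b) \<le> DIM('a) * norm h"
proof -
  have fin: "finite B" using assms finite_subset finite_Basis by blast
  have "norm (\<Sum>b\<in>B. (h \<bullet> b) *\<^sub>R b) \<le> (\<Sum>b\<in>B. norm h)"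
    using assms Basis_le_norm by (intro sum_norm_le) (auto simp: subset_iff)
  also have "\<dots> \<le> DIM('a) * norm h"
    using card_mono[OF finite_Basis assms] by (simp add: mult_right_mono)
  finally show ?thesis .
qed

text \<open>Walking from \<open>x\<close> to \<open>x + h\<close> along the coordinate axes, each corner is close to a point of \<open>K\<close>, where
  the partial difference quotients are controlled uniformly.\<close>

lemma approx_linear_at_dense_point:
  fixes f :: "'a::euclidean_space \<Rightarrow> real" and L e d d' :: real
  assumes lip: "\<And>x y. \<bar>f x - f y\<bar> \<le> L * norm (x - y)" and e: "e > 0"
    and K: "\<And>y b s. y \<in> K \<Longrightarrow> b \<in> Basis \<Longrightarrow> \<bar>s\<bar> < d \<Longrightarrow> \<bar>f (y + s *\<^sub>R b) - f y - (q \<bullet> b) * s\<bar> \<le> e * \<bar>s\<bar>"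
    and dense: "\<And>r y. 0 < r \<Longrightarrow> r < d' \<Longrightarrow> y \<in> ball x r \<Longrightarrow> ball y (e * r) \<inter> K \<noteq> {}"
    and h: "(1 + DIM('a)) * norm h < d'" "norm h < d"
  shows "\<bar>f (x + h) - f x - q \<bullet> h\<bar> \<le> DIM('a) * (1 + 2 * L * (1 + DIM('a))) * e * norm h"
proof (cases "h = 0")
  case True then show ?thesis by simp
next
  case False
  have L: "L \<ge> 0"
  proof -
    obtain b :: 'a where "b \<in> Basis" using nonempty_Basis by blast
    then show ?thesis using lip[of b 0] by simp
  qed
  define n where "n = real DIM('a)"
  \<comment> \<open>The price of one axis step: \<open>e * norm h\<close> for the difference
    quotient at a nearby point \<open>y\<close> of \<open>K\<close>, and twice
    \<open>L * (e * r)\<close> for moving both ends of the step from the corner to \<open>y\<close>.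
    The radius \<open>r\<close> strictly exceeds the norm of every partial sum, which is at most
    \<open>n * norm h\<close>.\<close>
  define c where "c = (1 + 2 * L * (1 + n)) * e * norm h"
  define r where "r = (1 + n) * norm h"
  have n0: "n \<ge> 0" by (simp add: n_def)
  have r: "0 < r" "r < d'" using h False n0 by (auto simp: r_def n_def)
  have "finite B \<Longrightarrow> B \<subseteq> Basis \<Longrightarrow>
    \<bar>f (x + (\<Sum>b\<in>B. (h \<bullet> b) *\<^sub>R b)) - f x - q \<bullet> (\<Sum>b\<in>B. (h \<bullet> b) *\<^sub>R b)\<bar> \<le> card B * c" for B :: "'a set"
  proof (induction B rule: finite_induct)
    case empty then show ?case by simp
  next
    case (insert b B)
    define u where "u = (\<Sum>b\<in>B. (h \<bullet> b) *\<^sub>R b)"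
    define s where "s = h \<bullet> b"
    have b: "b \<in> Basis" "B \<subseteq> Basis" using insert.prems by auto
    have sh: "\<bar>s\<bar> \<le> norm h" using Basis_le_norm[OF b(1)] by (simp add: s_def)
    have "norm u \<le> n * norm h" unfolding u_def n_def using norm_partial_sum_Basis_le[OF b(2)] .
    also have "\<dots> < r" using False by (simp add: r_def distrib_right)
    finally have "x + u \<in> ball x r" by (simp add: dist_norm)
    from dense[OF r this] obtain y where y: "y \<in> K" "norm (x + u - y) < e * r"
      by (auto simp: dist_norm)
    have "\<bar>f (y + s *\<^sub>R b) - f y - (q \<bullet> b) * s\<bar> \<le> e * \<bar>s\<bar>"
      using sh h(2) by (intro K y b) auto
    moreover have "e * \<bar>s\<bar> \<le> e * norm h" using sh e by (intro mult_left_mono) auto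
    moreover have "\<bar>f (x + u + s *\<^sub>R b) - f (y + s *\<^sub>R b)\<bar> \<le> L * norm (x + u - y)"
      using lip[of "x + u + s *\<^sub>R b" "y + s *\<^sub>R b"] by simp
    moreover have "\<bar>f (x + u) - f y\<bar> \<le> L * norm (x + u - y)"
      using lip[of "x + u" y] by simp
    moreover have "L * norm (x + u - y) \<le> L * (e * r)" using y(2) L by (intro mult_left_mono) auto
    ultimately have step: "\<bar>f (x + u + s *\<^sub>R b) - f (x + u) - (q \<bullet> b) * s\<bar> \<le> e * norm h + 2 * (L * (e * r))"
      by linarith
    have c: "e * norm h + 2 * (L * (e * r)) = c" by (simp add: c_def r_def algebra_simps)
    have sum: "(\<Sum>b\<in>insert b B. (h \<bullet> b) *\<^sub>R b) = u + s *\<^sub>R b"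
      using insert.hyps by (simp add: u_def s_def add.commute)
    have IH: "\<bar>f (x + u) - f x - q \<bullet> u\<bar> \<le> card B * c" using insert.IH b by (simp add: u_def)
    have "q \<bullet> (u + s *\<^sub>R b) = q \<bullet> u + (q \<bullet> b) * s" by (simp add: inner_add_right)
    then have "\<bar>f (x + (u + s *\<^sub>R b)) - f x - q \<bullet> (u + s *\<^sub>R b)\<bar> \<le> card B * c + c"
      using step c IH by (simp add: add.assoc)
    then show ?case using insert.hyps by (simp add: sum algebra_simps)
  qed
  from this[of Basis] show ?thesis
    by (simp add: euclidean_representation c_def n_def algebra_simps)
qed

lemma lipschitz_continuous_on_UNIV:
  fixes f :: "'a::real_normed_vector \<Rightarrow> 'b::real_normed_vector"
  assumes "\<And>x y. norm (f x - f y) \<le> L * norm (x - y)"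
  shows "continuous_on UNIV f"
proof -
  have "\<bar>L\<bar>-lipschitz_on UNIV f"
  proof (rule lipschitz_onI)
    fix x y :: 'a
    have "L * norm (x - y) \<le> \<bar>L\<bar> * norm (x - y)" by (intro mult_right_mono) auto
    then show "dist (f x) (f y) \<le> \<bar>L\<bar> * dist x y" using assms[of x y] by (simp add: dist_norm)
  qed simp
  then show ?thesis by (rule lipschitz_on_continuous_on)
qed

text \<open>Partial derivatives alone do not give differentiability; uniformity near the point is
  missing. Each set \<open>K q m k\<close> has uniform partial difference quotients, there are
  countably many of them, and almost every point of such a set has it almost dense around it. A good
  \<open>x\<close> lies in some \<open>K q m k\<close> for every accuracy
  \<open>\<epsilon> m\<close>, so \<open>f\<close> is approximately linear at \<open>x\<close> to
  every accuracy.\<close>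

theorem rademacher_real:
  fixes f :: "'a::euclidean_space \<Rightarrow> real"
  assumes lip: "\<And>x y. \<bar>f x - f y\<bar> \<le> L * norm (x - y)"
  shows "AE x in lborel. f differentiable (at x)"
proof -
  have cont: "continuous_on UNIV f"
    using lipschitz_continuous_on_UNIV[of f L] lip by simp
  obtain D :: "'a set" where D: "countable D" "\<And>X. open X \<Longrightarrow> X \<noteq> {} \<Longrightarrow> \<exists>d \<in> D. d \<in> X"
    using countable_dense_setE by blast
  define \<epsilon> where "\<epsilon> m = inverse (real (Suc m))" for m
  have \<epsilon>: "\<epsilon> m > 0" for m by (simp add: \<epsilon>_def)
  define K where "K q m k = (\<Inter>b\<in>Basis. diff_quot_set f b (q \<bullet> b) (\<epsilon> m) (\<epsilon> k))" for q :: 'a and m k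
  have "closed (K q m k)" for q m k
    unfolding K_def using closed_diff_quot_set[OF cont] by auto
  then have "AE x in lborel. \<forall>q\<in>D. \<forall>m k. x \<in> K q m k \<longrightarrow>
      (\<exists>d>0. \<forall>r. 0 < r \<and> r < d \<longrightarrow> (\<forall>y \<in> ball x r. ball y (\<epsilon> m * r) \<inter> K q m k \<noteq> {}))"
    unfolding AE_all_countable AE_ball_countable[OF D(1)] using AE_closed_almost_dense \<epsilon> by blast
  moreover have "AE x in lborel. \<forall>b\<in>Basis. \<exists>g. ((\<lambda>s. f (x + s *\<^sub>R b)) has_real_derivative g) (at 0)"
    using AE_directional_derivative[OF lip cont] by (subst AE_ball_countable) (auto intro: countable_finite)
  ultimately show ?thesis
  proof eventually_elim
    case (elim x)
    define C where "C = DIM('a) * (1 + 2 * \<bar>L\<bar> * (1 + DIM('a)))"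
    have C: "C > 0" unfolding C_def by (intro mult_pos_pos add_pos_nonneg) auto
    from elim(2) obtain g where g: "\<And>b. b \<in> Basis \<Longrightarrow> ((\<lambda>s. f (x + s *\<^sub>R b)) has_derivative (\<lambda>h. g b * h)) (at 0)"
      unfolding has_field_derivative_def by metis
    have "\<exists>g. (f has_derivative (\<lambda>h. g \<bullet> h)) (at x)"
    proof (rule has_derivative_if_approx_linear)
      fix e :: real assume e: "e > 0"
      obtain m where m: "\<epsilon> m < e / C" using reals_Archimedean[of "e / C"] e C by (auto simp: \<epsilon>_def)
      define gv where "gv = (\<Sum>b\<in>Basis. g b *\<^sub>R b)"
      have gvb: "gv \<bullet> b = g b" if "b \<in> Basis" for b using that by (simp add: gv_def)
      \<comment> \<open>The vector \<open>gv\<close> of partial derivatives is replaced by a member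
        of the countable dense set. Half of \<open>\<epsilon> m\<close> pays for this, the other
        half for the difference quotients themselves.\<close>
      obtain q where q: "q \<in> D" "norm (q - gv) < \<epsilon> m / 2"
        using D(2)[of "ball gv (\<epsilon> m / 2)"] \<epsilon>[of m] by (auto simp: dist_norm norm_minus_commute)
      have "\<exists>d>0. \<forall>s. \<bar>s\<bar> < d \<longrightarrow> \<bar>f (x + s *\<^sub>R b) - f x - g b * s\<bar> \<le> \<epsilon> m / 2 * \<bar>s\<bar>" if "b \<in> Basis" for b
      proof -
        have "\<epsilon> m / 2 > 0" using \<epsilon>[of m] by simp
        then show ?thesis using g[OF that] unfolding has_derivative_at_alt by fastforce
      qed
      then obtain d where d: "\<And>b. b \<in> Basis \<Longrightarrow> d b > 0"
        "\<And>b s. b \<in> Basis \<Longrightarrow> \<bar>s\<bar> < d b \<Longrightarrow> \<bar>f (x + s *\<^sub>R b) - f x - g b * s\<bar> \<le> \<epsilon> m / 2 * \<bar>s\<bar>"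
        by metis
      have "Min (d ` Basis) > 0" using d(1) by (subst Min_gr_iff) auto
      then obtain k where k: "\<epsilon> k < Min (d ` Basis)" using reals_Archimedean unfolding \<epsilon>_def by blast
      have xK: "x \<in> K q m k"
        unfolding K_def diff_quot_set_def
      proof (intro INT_I CollectI allI impI)
        fix b :: 'a and s :: real assume b: "b \<in> Basis" and s: "\<bar>s\<bar> < \<epsilon> k"
        have "\<epsilon> k < d b" using k b by (subst (asm) Min_gr_iff) auto
        then have "\<bar>f (x + s *\<^sub>R b) - f x - g b * s\<bar> \<le> \<epsilon> m / 2 * \<bar>s\<bar>" using s by (intro d b) auto
        moreover have "\<bar>(q \<bullet> b - g b) * s\<bar> \<le> \<epsilon> m / 2 * \<bar>s\<bar>"
        proof -
          have "\<bar>(q - gv) \<bullet> b\<bar> \<le> \<epsilon> m / 2" using Basis_le_norm[OF b, of "q - gv"] q(2) by linarith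
          then show ?thesis unfolding abs_mult by (intro mult_right_mono) (auto simp: inner_diff_left gvb b)
        qed
        ultimately have "\<bar>f (x + s *\<^sub>R b) - f x - (q \<bullet> b) * s\<bar> \<le> \<epsilon> m / 2 * \<bar>s\<bar> + \<epsilon> m / 2 * \<bar>s\<bar>"
          by (simp only: left_diff_distrib)
        then show "\<bar>f (x + s *\<^sub>R b) - f x - (q \<bullet> b) * s\<bar> \<le> \<epsilon> m * \<bar>s\<bar>" by (simp add: field_simps)
      qed
      then obtain d' where d': "d' > 0" "\<And>r y. 0 < r \<Longrightarrow> r < d' \<Longrightarrow> y \<in> ball x r \<Longrightarrow> ball y (\<epsilon> m * r) \<inter> K q m k \<noteq> {}"
        using elim(1) q(1) by metis
      show "\<exists>q d. d > 0 \<and> (\<forall>h. norm h < d \<longrightarrow> \<bar>f (x + h) - f x - q \<bullet> h\<bar> \<le> e * norm h)"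
      proof (rule exI[of _ q], rule exI[of _ "min (\<epsilon> k) (d' / (1 + DIM('a)))"], intro conjI allI impI)
        fix h :: 'a assume h: "norm h < min (\<epsilon> k) (d' / (1 + DIM('a)))"
        have "\<bar>f (x + h) - f x - q \<bullet> h\<bar> \<le> DIM('a) * (1 + 2 * \<bar>L\<bar> * (1 + DIM('a))) * \<epsilon> m * norm h"
        proof (rule approx_linear_at_dense_point[OF _ \<epsilon> _ d'(2)])
          show "\<bar>f u - f v\<bar> \<le> \<bar>L\<bar> * norm (u - v)" for u v
            using lip[of u v] mult_right_mono[OF abs_ge_self[of L] norm_ge_zero[of "u - v"]] by linarith
          show "\<bar>f (y + s *\<^sub>R b) - f y - (q \<bullet> b) * s\<bar> \<le> \<epsilon> m * \<bar>s\<bar>"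
            if "y \<in> K q m k" "b \<in> Basis" "\<bar>s\<bar> < \<epsilon> k" for y b s
            using that by (auto simp: K_def diff_quot_set_def)
        qed (use h in \<open>auto simp: field_simps\<close>)
        also have "\<dots> = (C * \<epsilon> m) * norm h" by (simp add: C_def)
        also have "\<dots> \<le> e * norm h" using m C by (intro mult_right_mono) (auto simp: field_simps)
        finally show "\<bar>f (x + h) - f x - q \<bullet> h\<bar> \<le> e * norm h" .
      qed (use d'(1) \<epsilon>[of k] in auto)
    qed
    then show ?case by (auto simp: differentiable_def)
  qed
qed

theorem rademacher:
  fixes f :: "'a::euclidean_space \<Rightarrow> 'b::euclidean_space"
  assumes lip: "\<And>x y. norm (f x - f y) \<le> L * norm (x - y)"
  shows "AE x in lborel. f differentiable (at x)"
proof -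
  have "AE x in lborel. (\<lambda>x. f x \<bullet> i) differentiable (at x)" if "i \<in> Basis" for i
  proof (rule rademacher_real)
    fix x y
    show "\<bar>f x \<bullet> i - f y \<bullet> i\<bar> \<le> L * norm (x - y)"
      using Basis_le_norm[OF that, of "f x - f y"] lip[of x y] by (simp add: inner_diff_left)
  qed
  then have "AE x in lborel. \<forall>i\<in>Basis. (\<lambda>x. f x \<bullet> i) differentiable (at x)"
    by (subst AE_ball_countable) (auto intro: countable_finite)
  then show ?thesis
    by eventually_elim (use differentiable_componentwise_within[of f _ UNIV] in auto)
qed

section \<open>Mean value inequalities\<close>

lemma AE_lborel_imp_null_set:
  assumes "AE x in lborel. P x"
  shows "\<exists>Z \<in> null_sets lborel. \<forall>x. x \<notin> Z \<longrightarrow> P x"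
  by (rule AE_E3[OF assms]) auto

text \<open>This takes the place of integrating a derivative. The nondecreasing function
  \<open>L * x - \<phi> x\<close> has local slopes at least \<open>L - k - e\<close> off a null set
  \<open>Z\<close>, and the Vitali bound on \<open>- Z\<close>, which has full measure in
  \<open>{a..b}\<close>, limits the increment of \<phi>.\<close>

lemma lipschitz_increment_le:
  fixes \<phi> :: "real \<Rightarrow> real"
  assumes lip: "\<And>x y. \<bar>\<phi> x - \<phi> y\<bar> \<le> L * \<bar>x - y\<bar>" and ab: "a \<le> b"
    and slope: "AE t in lborel. \<forall>e>0. \<exists>d>0. \<forall>u v. u < t \<and> t < v \<and> v - u < d \<longrightarrow> \<phi> v - \<phi> u \<le> (k + e) * (v - u)"
  shows "\<phi> b - \<phi> a \<le> k * (b - a)"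
proof (rule field_le_epsilon)
  fix e' :: real assume e': "e' > 0"
  \<comment> \<open>Adding 1 keeps the denominator positive when \<open>a = b\<close>.\<close>
  define e where "e = e' / (b - a + 1)"
  have e: "e > 0" using e' ab by (simp add: e_def)
  have "AE t in lborel. \<exists>d>0. \<forall>u v. u < t \<and> t < v \<and> v - u < d \<longrightarrow> \<phi> v - \<phi> u \<le> (k + e) * (v - u)"
    using slope by eventually_elim (use e in blast)
  from AE_lborel_imp_null_set[OF this] obtain Z where Z: "Z \<in> null_sets lborel" and Z': "\<And>t. t \<notin> Z \<Longrightarrow>
      \<exists>d>0. \<forall>u v. u < t \<and> t < v \<and> v - u < d \<longrightarrow> \<phi> v - \<phi> u \<le> (k + e) * (v - u)"
    by blast
  have L: "L \<ge> 0" using lip[of 0 1] by simp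
  have cont: "continuous_on UNIV \<phi>" using lipschitz_continuous_on_UNIV[of \<phi> L] lip by simp
  have Zm: "- Z \<in> sets borel" using Z by (auto simp: null_sets_def)
  have "(L - k - e) * measure lborel (- Z \<inter> {a..b}) \<le> (L * b - \<phi> b) - (L * a - \<phi> a)"
  proof (rule mono_slope_measure_bound[OF _ _ Zm ab])
    fix x y :: real assume "x \<le> y"
    then show "L * x - \<phi> x \<le> L * y - \<phi> y" using lip[of x y] by (simp add: algebra_simps)
  next
    fix t d :: real assume t: "t \<in> - Z" and d: "0 < d"
    obtain d' where d': "d' > 0" "\<And>u v. u < t \<and> t < v \<and> v - u < d' \<Longrightarrow> \<phi> v - \<phi> u \<le> (k + e) * (v - u)"
      using Z'[of t] t by auto
    define s where "s = min d d' / 3"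
    have s: "s > 0" "2 * s < d" "2 * s < d'" using d d' by (auto simp: s_def)
    have "\<phi> (t + s) - \<phi> (t - s) \<le> (k + e) * ((t + s) - (t - s))" using s by (intro d') auto
    with s show "\<exists>u v. u < t \<and> t < v \<and> v - u < d \<and> (L - k - e) * (v - u) \<le> L * v - \<phi> v - (L * u - \<phi> u)"
      by (intro exI[of _ "t - s"] exI[of _ "t + s"]) (auto simp: algebra_simps)
  qed (auto intro!: continuous_intros cont)
  moreover have "measure lborel (- Z \<inter> {a..b}) = b - a"
    using measure_Diff_null_set[OF _ Z, of "{a..b}"] ab by (simp add: Diff_eq Int_commute)
  ultimately have "\<phi> b - \<phi> a \<le> k * (b - a) + e * (b - a)" by (simp add: algebra_simps)
  also have "e * (b - a) \<le> e'" using e' ab by (simp add: e_def field_simps)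
  finally show "\<phi> b - \<phi> a \<le> k * (b - a) + e'" by simp
qed

section \<open>Norms as functions and their equivalence with the Euclidean norm\<close>

context
  fixes N :: "real^'n \<Rightarrow> real"
  assumes norm: "is_norm N"
begin

lemma is_norm_simps:
  shows is_norm_nonneg: "N x \<ge> 0"
    and is_norm_eq_0: "N x = 0 \<longleftrightarrow> x = 0"
    and is_norm_scaleR: "N (a *\<^sub>R x) = \<bar>a\<bar> * N x"
    and is_norm_triangle: "N (x + y) \<le> N x + N y"
  using norm unfolding is_norm_def by blast+

lemma is_norm_minus: "N (- x) = N x"
  using is_norm_scaleR[of "-1" x] by simp

lemma is_norm_minus_commute: "N (x - y) = N (y - x)"
  using is_norm_minus[of "x - y"] by simp

lemma is_norm_triangle_diff: "N (x - y) \<le> N x + N y"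
  using is_norm_triangle[of x "- y"] is_norm_minus by simp

lemma is_norm_triangle_via: "N (x - z) \<le> N (x - y) + N (y - z)"
  using is_norm_triangle[of "x - y" "y - z"] by simp

lemma is_norm_zero: "N 0 = 0"
  using is_norm_eq_0 by simp

lemma is_norm_pos: "x \<noteq> 0 \<Longrightarrow> N x > 0"
  using is_norm_nonneg[of x] is_norm_eq_0[of x] by simp

lemma is_norm_sum: "N (sum f S) \<le> (\<Sum>i\<in>S. N (f i))"
  by (induction S rule: infinite_finite_induct) (auto simp: is_norm_zero intro: order_trans[OF is_norm_triangle])

lemma is_norm_abs_diff: "\<bar>N x - N y\<bar> \<le> N (x - y)"
  using is_norm_triangle[of "x - y" y] is_norm_triangle[of "y - x" x] is_norm_minus_commute[of x y] by simp

lemma is_norm_le_norm: "\<exists>B>0. \<forall>x. N x \<le> B * norm x"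
proof (intro exI conjI allI)
  define S where "S = (\<Sum>b\<in>Basis. N b)"
  let ?B = "1 + S"
  show "?B > 0" by (simp add: S_def add_pos_nonneg sum_nonneg is_norm_nonneg)
  fix x :: "real^'n"
  have "N x = N (\<Sum>b\<in>Basis. (x \<bullet> b) *\<^sub>R b)" by (simp add: euclidean_representation)
  also have "\<dots> \<le> (\<Sum>b\<in>Basis. N ((x \<bullet> b) *\<^sub>R b))" by (rule is_norm_sum)
  also have "\<dots> \<le> (\<Sum>b\<in>Basis. norm x * N b)"
    by (intro sum_mono) (auto simp: is_norm_scaleR intro!: mult_right_mono Basis_le_norm is_norm_nonneg)
  also have "\<dots> \<le> ?B * norm x" unfolding sum_distrib_left[symmetric] S_def[symmetric] by (simp add: algebra_simps)
  finally show "N x \<le> ?B * norm x" .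
qed

lemma continuous_is_norm: "continuous_on UNIV N"
proof -
  obtain B where "\<And>x. N x \<le> B * norm x" using is_norm_le_norm by blast
  then have "norm (N x - N y) \<le> B * norm (x - y)" for x y
    using is_norm_abs_diff[of x y] order_trans by fastforce
  then show ?thesis by (rule lipschitz_continuous_on_UNIV)
qed

lemma continuous_on_is_norm [continuous_intros]:
  "continuous_on S f \<Longrightarrow> continuous_on S (\<lambda>x. N (f x))"
  by (rule continuous_on_compose2[OF continuous_is_norm]) auto

lemma tendsto_is_norm [tendsto_intros]:
  "(f \<longlongrightarrow> a) \<F> \<Longrightarrow> ((\<lambda>x. N (f x)) \<longlongrightarrow> N a) \<F>"
  using continuous_is_norm by (auto intro: isCont_tendsto_compose simp: continuous_on_eq_continuous_at)

lemma norm_le_is_norm: "\<exists>B>0. \<forall>x. norm x \<le> B * N x"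
proof -
  have "compact (sphere (0::real^'n) 1)" "sphere (0::real^'n) 1 \<noteq> {}" by auto
  then obtain u where u: "u \<in> sphere 0 1" "\<And>y. y \<in> sphere 0 1 \<Longrightarrow> N u \<le> N y"
    using continuous_attains_inf[of "sphere 0 1" N] continuous_is_norm continuous_on_subset by blast
  have Nu: "N u > 0" using u(1) by (intro is_norm_pos) auto
  have "norm x \<le> 1 / N u * N x" for x
  proof (cases "x = 0")
    case True then show ?thesis by (simp add: is_norm_zero)
  next
    case False
    then have "N u \<le> N ((1 / norm x) *\<^sub>R x)" by (intro u(2)) auto
    also have "\<dots> = N x / norm x" by (simp add: is_norm_scaleR)
    finally show ?thesis using Nu False by (simp add: field_simps)
  qed
  with Nu show ?thesis by (intro exI[of _ "1 / N u"]) auto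
qed

text \<open>The segment from \<open>x\<close> to \<open>x + v\<close> may miss every point of
  differentiability, so the estimate is made on the segments from \<open>z\<close> to
  \<open>z + v\<close> for almost all \<open>z\<close>; the resulting condition on \<open>z\<close>
  is closed. Only the fixed direction \<open>v\<close> enters, so \<open>k\<close> bounds
  \<open>N (D v)\<close> and no operator norm is needed.\<close>

lemma lipschitz_mean_value:
  fixes G :: "'a::euclidean_space \<Rightarrow> real^'n"
  assumes lip: "\<And>x y. norm (G x - G y) \<le> L * norm (x - y)"
    and deriv: "\<And>z D. (G has_derivative D) (at z) \<Longrightarrow> N (D v) \<le> k"
  shows "N (G (x + v) - G x) \<le> k"
proof -
  obtain B where B: "B > 0" "\<And>x. N x \<le> B * norm x" using is_norm_le_norm by blast
  have cont: "continuous_on UNIV G" by (rule lipschitz_continuous_on_UNIV[OF lip])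
  obtain E where E: "\<And>z. z \<notin> E \<Longrightarrow> G differentiable (at z)" "E \<in> null_sets lborel"
    using AE_lborel_imp_null_set[OF rademacher[OF lip]] by blast
  then have "E \<in> sets borel" "AE z in lborel. z \<notin> E" by (auto simp: AE_not_in)
  then have "AE z in lborel. AE t::real in lborel. z + t *\<^sub>R v \<notin> E"
    using AE_lines_iff[of E v] by simp
  then have "AE z in lborel. z \<in> {z. N (G (z + v) - G z) \<le> k}"
  proof eventually_elim
    case (elim z)
    \<comment> \<open>A scalar function that carries the whole increment: it is 0 at 0, and its
      increments are bounded by the \<open>N\<close>-increments of \<open>G\<close> along the
      segment.\<close>
    define \<phi> where "\<phi> t = N (G (z + t *\<^sub>R v) - G z)" for t
    have \<phi>: "\<bar>\<phi> t - \<phi> s\<bar> \<le> N (G (z + t *\<^sub>R v) - G (z + s *\<^sub>R v))" for t s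
      using is_norm_abs_diff[of "G (z + t *\<^sub>R v) - G z" "G (z + s *\<^sub>R v) - G z"] by (simp add: \<phi>_def)
    have "\<phi> 1 - \<phi> 0 \<le> k * (1 - 0)"
    proof (rule lipschitz_increment_le)
      fix t s :: real
      have "\<bar>\<phi> t - \<phi> s\<bar> \<le> B * (L * norm ((z + t *\<^sub>R v) - (z + s *\<^sub>R v)))"
        using \<phi>[of t s] B(2)[of "G (z + t *\<^sub>R v) - G (z + s *\<^sub>R v)"]
          mult_left_mono[OF lip[of "z + t *\<^sub>R v" "z + s *\<^sub>R v"], of B] B(1) by linarith
      then show "\<bar>\<phi> t - \<phi> s\<bar> \<le> (B * L * norm v) * \<bar>t - s\<bar>"
        by (simp add: mult_ac flip: scaleR_diff_left)
    next
      show "AE t in lborel. \<forall>e>0. \<exists>d>0. \<forall>u w. u < t \<and> t < w \<and> w - u < d \<longrightarrow> \<phi> w - \<phi> u \<le> (k + e) * (w - u)"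
        using elim
      proof eventually_elim
        case (elim t)
        show ?case
        proof (intro allI impI)
          fix e :: real assume e: "e > 0"
          obtain D where D: "(G has_derivative D) (at (z + t *\<^sub>R v))"
            using E(1) elim by (auto simp: differentiable_def)
          define g where "g s = G (z + s *\<^sub>R v)" for s
          have "((\<lambda>s. z + s *\<^sub>R v) has_derivative (\<lambda>h. h *\<^sub>R v)) (at t)"
            by (auto intro!: derivative_eq_intros)
          from has_derivative_compose[OF this] D
          have "(g has_derivative (\<lambda>h. D (h *\<^sub>R v))) (at t)" by (simp add: g_def[abs_def])
          moreover have Dl: "D (h *\<^sub>R v) = h *\<^sub>R D v" for h
            using has_derivative_linear[OF D] by (simp add: linear_scale)
          moreover have "e / B > 0" using e B by simp
          ultimately obtain d where d: "d > 0"
            "\<And>s. norm (s - t) < d \<Longrightarrow> norm (g s - g t - (s - t) *\<^sub>R D v) \<le> e / B * norm (s - t)"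
            unfolding has_derivative_at_alt by metis
          have Ng: "N (g s - g t - (s - t) *\<^sub>R D v) \<le> e * \<bar>s - t\<bar>" if "\<bar>s - t\<bar> < d" for s
          proof -
            have "N (g s - g t - (s - t) *\<^sub>R D v) \<le> B * (e / B * \<bar>s - t\<bar>)"
              using B(2)[of "g s - g t - (s - t) *\<^sub>R D v"] mult_left_mono[OF d(2)[of s], of B] that B(1) by simp
            then show ?thesis using B(1) by simp
          qed
          have "\<phi> w - \<phi> u \<le> (k + e) * (w - u)" if uw: "u < t \<and> t < w \<and> w - u < d" for u w
          proof -
            have eq: "g w - g u = (w - u) *\<^sub>R D v + ((g w - g t - (w - t) *\<^sub>R D v) - (g u - g t - (u - t) *\<^sub>R D v))"
              by (simp add: algebra_simps)
            have "\<phi> w - \<phi> u \<le> N (g w - g u)" using \<phi>[of w u] by (simp add: g_def)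
            also have "\<dots> \<le> N ((w - u) *\<^sub>R D v) + (N (g w - g t - (w - t) *\<^sub>R D v) + N (g u - g t - (u - t) *\<^sub>R D v))"
              unfolding eq by (intro order_trans[OF is_norm_triangle] add_left_mono is_norm_triangle_diff)
            also have "\<dots> \<le> (w - u) * k + (e * (w - t) + e * (t - u))"
              using Ng[of w] Ng[of u] uw deriv[OF D] by (intro add_mono) (auto simp: is_norm_scaleR)
            also have "\<dots> = (k + e) * (w - u)" by (simp add: algebra_simps)
            finally show ?thesis .
          qed
          then show "\<exists>d>0. \<forall>u w. u < t \<and> t < w \<and> w - u < d \<longrightarrow> \<phi> w - \<phi> u \<le> (k + e) * (w - u)"
            using d(1) by blast
        qed
      qed
    qed simp
    then show ?case by (simp add: \<phi>_def is_norm_zero)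
  qed
  moreover have "closed {z. N (G (z + v) - G z) \<le> k}"
    by (intro closed_Collect_le continuous_intros continuous_on_compose2[OF cont]) auto
  ultimately show ?thesis using mem_closed_if_AE_lborel by blast
qed

section \<open>Lipschitz and monotone maps with respect to an arbitrary norm\<close>

lemma lipschitz_wrt_imp_lipschitz:
  assumes "lipschitz_wrt F N l"
  shows "\<exists>L. \<forall>x y. norm (F x - F y) \<le> L * norm (x - y)"
proof -
  obtain B where B: "B > 0" "\<And>x. N x \<le> B * norm x" using is_norm_le_norm by blast
  obtain C where C: "C > 0" "\<And>x. norm x \<le> C * N x" using norm_le_is_norm by blast
  have "norm (F x - F y) \<le> (C * \<bar>l\<bar> * B) * norm (x - y)" for x y
  proof -
    have "norm (F x - F y) \<le> C * N (F x - F y)" by (rule C)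
    also have "\<dots> \<le> C * (l * N (x - y))"
      using assms C(1) by (intro mult_left_mono) (auto simp: lipschitz_wrt_def)
    also have "\<dots> \<le> C * (\<bar>l\<bar> * N (x - y))"
      using C(1) is_norm_nonneg by (intro mult_left_mono mult_right_mono) auto
    also have "\<dots> \<le> C * (\<bar>l\<bar> * (B * norm (x - y)))"
      using C(1) B(2) by (intro mult_left_mono) auto
    finally show ?thesis by (simp add: mult_ac)
  qed
  then show ?thesis by blast
qed

lemma lipschitz_wrt_nonneg:
  assumes "lipschitz_wrt F N l"
  shows "l \<ge> 0"
proof -
  have "(axis undefined 1 :: real^'n) \<noteq> 0" by (simp add: axis_eq_0_iff)
  then have "N (axis undefined 1) > 0" by (rule is_norm_pos)
  moreover have "0 \<le> l * N (axis undefined 1 - 0)"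
    using assms is_norm_nonneg order_trans unfolding lipschitz_wrt_def by blast
  ultimately show ?thesis by (simp add: zero_le_mult_iff)
qed

text \<open>The map \<open>t \<mapsto> N (v - t w)\<close> is convex, so its chord from \<open>0\<close> to \<open>t\<close> is no steeper than its right derivative
  at \<open>t\<close>. For almost all \<open>t\<close> the curve norm derivative formula expresses the latter by the weak pairing.\<close>

lemma forward_step_pair_bound:
  assumes lip: "lipschitz_wrt F N l" and mon: "monotone_param F N c" and t: "t \<ge> 0"
  shows "(1 + c * t) * N (x - y - t *\<^sub>R (F x - F y)) \<le> (1 + l\<^sup>2 * t\<^sup>2) * N (x - y)"
proof -
  obtain WP where WP: "weak_pairing WP" "wp_compatible WP N" "curve_norm_formula WP N"
    "\<And>x y. c * (N (x - y))\<^sup>2 \<le> - WP (- (F x - F y)) (x - y)"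
    using mon unfolding monotone_param_def by blast
  have c: "c \<ge> 0" using mon by (simp add: monotone_param_def)
  have l: "l \<ge> 0" using lipschitz_wrt_nonneg[OF lip] .
  define v where "v = x - y"
  define w where "w = F x - F y"
  define \<gamma> where "\<gamma> s = v - s *\<^sub>R w" for s
  define g where "g s = N (\<gamma> s)" for s
  \<comment> \<open>The point \<open>\<gamma> s\<close> divides the segment from
    \<open>\<gamma> 0\<close> to \<open>\<gamma> (s + h)\<close> with weights \<open>h\<close> and
    \<open>s\<close>; the inequality compares consecutive chord slopes.\<close>
  have convex: "h * (g s - g 0) \<le> s * (g (s + h) - g s)" if "s > 0" "h > 0" for s h
  proof -
    have "(s + h) *\<^sub>R \<gamma> s = h *\<^sub>R \<gamma> 0 + s *\<^sub>R \<gamma> (s + h)" by (simp add: \<gamma>_def algebra_simps)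
    then have "N ((s + h) *\<^sub>R \<gamma> s) \<le> N (h *\<^sub>R \<gamma> 0) + N (s *\<^sub>R \<gamma> (s + h))" using is_norm_triangle by metis
    then have "(s + h) * g s \<le> h * g 0 + s * g (s + h)" using that by (simp add: is_norm_scaleR g_def)
    then show ?thesis by (simp add: algebra_simps)
  qed
  have "AE s in lborel. ereal (N (\<gamma> s)) * upper_dini (\<lambda>s. N (\<gamma> s)) s = ereal (WP (- w) (\<gamma> s))"
  proof -
    have "(\<gamma> has_vector_derivative - w) (at s)" for s
      unfolding \<gamma>_def[abs_def] by (auto intro!: derivative_eq_intros)
    then show ?thesis using WP(3)[unfolded curve_norm_formula_def, rule_format, of \<gamma> "\<lambda>_. - w"] by simp
  qed
  \<comment> \<open>Including \<open>s \<le> 0\<close> keeps the set closed while leaving positive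
    \<open>s\<close>, where chords from 0 make sense, as the only case to prove.\<close>
  then have "AE s in lborel. s \<in> {s. s \<le> 0 \<or> (1 + c * s) * g s \<le> (1 + l\<^sup>2 * s\<^sup>2) * N v}"
  proof eventually_elim
    case (elim s)
    have g0: "g 0 = N v" by (simp add: g_def \<gamma>_def)
    have "(1 + c * s) * g s \<le> (1 + l\<^sup>2 * s\<^sup>2) * N v" if s: "s > 0"
    proof (cases "g s = 0")
      case True
      then show ?thesis using is_norm_nonneg by simp
    next
      case False
      then have gs: "g s > 0" using is_norm_nonneg[of "\<gamma> s"] by (simp add: g_def)
      define \<sigma> where "\<sigma> = (g s - g 0) / s"
      have "\<forall>\<^sub>F h in at_right 0. ereal \<sigma> \<le> ereal ((g (s + h) - g s) / h)"
        using eventually_at_right_less[of "0::real"]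
      proof eventually_elim
        case (elim h)
        then show ?case using convex[OF s elim] s by (simp add: \<sigma>_def field_simps)
      qed
      then have "ereal \<sigma> \<le> upper_dini g s"
        unfolding upper_dini_def by (intro le_Limsup) auto
      then have "ereal (g s) * ereal \<sigma> \<le> ereal (g s) * upper_dini g s"
        using gs by (intro ereal_mult_left_mono) auto
      also have "\<dots> = ereal (WP (- w) (\<gamma> s))" using elim by (simp add: g_def[abs_def])
      finally have 1: "g s * \<sigma> \<le> WP (- w) (\<gamma> s)" by simp
      \<comment> \<open>Moving \<open>x\<close> rather than the difference makes
        \<open>x' - y\<close> the curve point \<open>\<gamma> s\<close>, so monotonicity applies to
        \<open>x'\<close> and \<open>y\<close>. The remaining \<open>F x' - F x\<close> has norm at
        most \<open>l * s * N w\<close>, hence at most \<open>l\<^sup>2 * s * N v\<close>.\<close>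
      define x' where "x' = x - s *\<^sub>R w"
      have x': "x' - y = \<gamma> s" by (simp add: x'_def \<gamma>_def v_def)
      have "- w = - (F x' - F y) + (F x' - F x)" by (simp add: w_def)
      then have "WP (- w) (\<gamma> s) \<le> WP (- (F x' - F y)) (\<gamma> s) + WP (F x' - F x) (\<gamma> s)"
        using WP(1) unfolding weak_pairing_def by metis
      moreover have "WP (- (F x' - F y)) (\<gamma> s) \<le> - c * (g s)\<^sup>2"
        using WP(4)[of x' y] by (simp add: x' g_def)
      moreover have "WP (F x' - F x) (\<gamma> s) \<le> N (F x' - F x) * g s"
      proof -
        have "\<bar>WP (F x' - F x) (\<gamma> s)\<bar> \<le> sqrt (WP (F x' - F x) (F x' - F x)) * sqrt (WP (\<gamma> s) (\<gamma> s))"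
          using WP(1) unfolding weak_pairing_def by blast
        then show ?thesis using WP(2) is_norm_nonneg by (simp add: wp_compatible_def g_def)
      qed
      moreover have "N (F x' - F x) * g s \<le> (l\<^sup>2 * s * N v) * g s"
      proof (rule mult_right_mono)
        have "N (F x' - F x) \<le> l * N (x' - x)" using lip by (simp add: lipschitz_wrt_def)
        also have "N (x' - x) = s * N w" using s by (simp add: x'_def is_norm_minus is_norm_scaleR)
        also have "l * (s * N w) \<le> l * (s * (l * N v))"
          using lip s l by (intro mult_left_mono) (auto simp: lipschitz_wrt_def w_def v_def)
        finally show "N (F x' - F x) \<le> l\<^sup>2 * s * N v" by (simp add: power2_eq_square mult_ac)
      qed (use gs in simp)
      ultimately have "g s * \<sigma> \<le> g s * (- c * g s + l\<^sup>2 * s * N v)"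
        using 1 by (simp add: power2_eq_square algebra_simps)
      then have "\<sigma> \<le> - c * g s + l\<^sup>2 * s * N v" using gs by simp
      then have "s * \<sigma> \<le> s * (- c * g s + l\<^sup>2 * s * N v)" using s by simp
      moreover have "s * \<sigma> = g s - g 0" using s by (simp add: \<sigma>_def)
      ultimately show ?thesis by (simp add: g0 power2_eq_square algebra_simps)
    qed
    then show ?case by fastforce
  qed
  moreover have "closed {s. s \<le> 0 \<or> (1 + c * s) * g s \<le> (1 + l\<^sup>2 * s\<^sup>2) * N v}"
    unfolding g_def \<gamma>_def by (intro closed_Collect_disj closed_Collect_le continuous_intros)
  ultimately have "t \<in> {s. s \<le> 0 \<or> (1 + c * s) * g s \<le> (1 + l\<^sup>2 * s\<^sup>2) * N v}"
    using mem_closed_if_AE_lborel by blast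
  then show ?thesis using t by (auto simp: g_def \<gamma>_def v_def w_def)
qed

section \<open>Passage from difference quotients to derivatives\<close>

lemma difference_quotient_LIMSEQ:
  fixes F :: "real^'n \<Rightarrow> real^'n"
  assumes "(F has_derivative A) (at z)"
  shows "(\<lambda>m. real (Suc m) *\<^sub>R (F (z + inverse (real (Suc m)) *\<^sub>R h) - F z)) \<longlonglongrightarrow> A h"
proof -
  have "((\<lambda>s. z + s *\<^sub>R h) has_derivative (\<lambda>s. s *\<^sub>R h)) (at (0::real))"
    by (auto intro!: derivative_eq_intros)
  from has_derivative_compose[OF this] assms
  have "((\<lambda>s. F (z + s *\<^sub>R h)) has_derivative (\<lambda>s. A (s *\<^sub>R h))) (at (0::real))" by simp
  moreover have "A (s *\<^sub>R h) = s *\<^sub>R A h" for s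
    using has_derivative_linear[OF assms] by (simp add: linear_scale)
  ultimately have "((\<lambda>s::real. norm (F (z + s *\<^sub>R h) - F z - s *\<^sub>R A h) / norm s) \<longlongrightarrow> 0) (at 0)"
    by (simp add: has_derivative_at)
  moreover have "\<forall>\<^sub>F s::real in at 0. norm (F (z + s *\<^sub>R h) - F z - s *\<^sub>R A h) / norm s =
      norm ((F (z + s *\<^sub>R h) - F z) /\<^sub>R s - A h)"
    unfolding eventually_at_filter
  proof (intro always_eventually allI impI)
    fix s :: real assume "s \<noteq> 0"
    then have "(F (z + s *\<^sub>R h) - F z) /\<^sub>R s - A h = (F (z + s *\<^sub>R h) - F z - s *\<^sub>R A h) /\<^sub>R s"
      by (simp add: scaleR_diff_right)
    then show "norm (F (z + s *\<^sub>R h) - F z - s *\<^sub>R A h) / norm s = norm ((F (z + s *\<^sub>R h) - F z) /\<^sub>R s - A h)"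
      by (simp add: divide_inverse mult.commute)
  qed
  ultimately have "((\<lambda>s::real. norm ((F (z + s *\<^sub>R h) - F z) /\<^sub>R s - A h)) \<longlongrightarrow> 0) (at 0)"
    by (rule Lim_transform_eventually)
  then have "((\<lambda>s. (F (z + s *\<^sub>R h) - F z) /\<^sub>R s) \<longlongrightarrow> A h) (at (0::real))"
    by (simp only: tendsto_norm_zero_iff LIM_zero_iff)
  moreover have "filterlim (\<lambda>m. inverse (real (Suc m))) (at 0) sequentially"
    unfolding filterlim_at using LIMSEQ_inverse_real_of_nat by auto
  ultimately have "(\<lambda>m. (F (z + inverse (real (Suc m)) *\<^sub>R h) - F z) /\<^sub>R inverse (real (Suc m))) \<longlonglongrightarrow> A h"
    by (rule filterlim_compose)
  then show ?thesis by simp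
qed

lemma lipschitz_wrt_derivative_bound:
  assumes lip: "lipschitz_wrt F N l" and A: "(F has_derivative A) (at z)"
  shows "N (A h) \<le> l * N h"
proof (rule LIMSEQ_le_const2)
  show "(\<lambda>m. N (real (Suc m) *\<^sub>R (F (z + inverse (real (Suc m)) *\<^sub>R h) - F z))) \<longlonglongrightarrow> N (A h)"
    by (intro tendsto_is_norm difference_quotient_LIMSEQ A)
  have "N (real (Suc m) *\<^sub>R (F (z + inverse (real (Suc m)) *\<^sub>R h) - F z)) \<le> l * N h" for m
  proof -
    define s where "s = real (Suc m)"
    have s: "s > 0" by (simp add: s_def)
    have "N (F (z + inverse s *\<^sub>R h) - F z) \<le> l * N ((z + inverse s *\<^sub>R h) - z)"
      using lip unfolding lipschitz_wrt_def by blast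
    then have "s * N (F (z + inverse s *\<^sub>R h) - F z) \<le> l * N h" using s by (simp add: is_norm_scaleR field_simps)
    then show ?thesis unfolding s_def[symmetric] is_norm_scaleR using s by simp
  qed
  then show "\<exists>M. \<forall>m\<ge>M. N (real (Suc m) *\<^sub>R (F (z + inverse (real (Suc m)) *\<^sub>R h) - F z)) \<le> l * N h" by blast
qed

text \<open>The pair bound is homogeneous: for the points \<open>z + h / s\<close> and
  \<open>z\<close> it can be multiplied by \<open>s\<close> while \<open>t\<close> stays fixed.
  Letting \<open>s\<close> grow replaces the difference quotient by \<open>A h\<close>.\<close>

lemma forward_step_derivative_bound:
  assumes lip: "lipschitz_wrt F N l" and mon: "monotone_param F N c" and t: "t \<ge> 0"
    and A: "(F has_derivative A) (at z)"
  shows "(1 + c * t) * N (h - t *\<^sub>R A h) \<le> (1 + l\<^sup>2 * t\<^sup>2) * N h"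
proof (rule LIMSEQ_le_const2)
  let ?q = "\<lambda>m. real (Suc m) *\<^sub>R (F (z + inverse (real (Suc m)) *\<^sub>R h) - F z)"
  show "(\<lambda>m. (1 + c * t) * N (h - t *\<^sub>R ?q m)) \<longlonglongrightarrow> (1 + c * t) * N (h - t *\<^sub>R A h)"
    by (intro tendsto_intros tendsto_is_norm difference_quotient_LIMSEQ A)
  have "(1 + c * t) * N (h - t *\<^sub>R ?q m) \<le> (1 + l\<^sup>2 * t\<^sup>2) * N h" for m
  proof -
    define s where "s = real (Suc m)"
    have s: "s > 0" by (simp add: s_def)
    define u where "u = F (z + inverse s *\<^sub>R h) - F z"
    have "(1 + c * t) * N ((z + inverse s *\<^sub>R h) - z - t *\<^sub>R u) \<le> (1 + l\<^sup>2 * t\<^sup>2) * N ((z + inverse s *\<^sub>R h) - z)"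
      unfolding u_def by (rule forward_step_pair_bound[OF lip mon t])
    moreover have "(z + inverse s *\<^sub>R h) - z - t *\<^sub>R u = inverse s *\<^sub>R (h - t *\<^sub>R s *\<^sub>R u)"
      using s by (simp add: scaleR_diff_right)
    ultimately have "inverse s * ((1 + c * t) * N (h - t *\<^sub>R s *\<^sub>R u)) \<le> inverse s * ((1 + l\<^sup>2 * t\<^sup>2) * N h)"
      using s by (simp add: is_norm_scaleR mult_ac)
    then have "(1 + c * t) * N (h - t *\<^sub>R s *\<^sub>R u) \<le> (1 + l\<^sup>2 * t\<^sup>2) * N h"
      using s by (simp only: mult_le_cancel_left_pos positive_imp_inverse_positive)
    then show ?thesis by (simp add: s_def u_def)
  qed
  then show "\<exists>M. \<forall>m\<ge>M. (1 + c * t) * N (h - t *\<^sub>R ?q m) \<le> (1 + l\<^sup>2 * t\<^sup>2) * N h" by blast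
qed

end

section \<open>Forward steps and their iterates\<close>

lemma derivative_diff_scaleR_imp:
  fixes F :: "real^'n \<Rightarrow> real^'n"
  assumes "\<alpha> \<noteq> 0" "((\<lambda>x. x - \<alpha> *\<^sub>R F x) has_derivative D) (at z)"
  shows "(F has_derivative (\<lambda>h. (h - D h) /\<^sub>R \<alpha>)) (at z)"
proof -
  have "((\<lambda>x. (x - (x - \<alpha> *\<^sub>R F x)) /\<^sub>R \<alpha>) has_derivative (\<lambda>h. (h - D h) /\<^sub>R \<alpha>)) (at z)"
    by (intro derivative_intros assms(2))
  then show ?thesis using assms(1) by simp
qed

context
  fixes N :: "real^'n \<Rightarrow> real"
  assumes norm: "is_norm N"
begin

text \<open>Since \<alpha> is nonzero, wherever the forward step is differentiable so is
  \<open>F\<close>; a bound on \<open>I - \<alpha> A\<close> for all derivatives \<open>A\<close> of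
  \<open>F\<close> is therefore all that the mean value inequality asks for.\<close>

lemma forward_step_lipschitz:
  assumes lip: "lipschitz_wrt F N l" and \<alpha>: "\<alpha> > 0"
    and deriv: "\<And>z A h. (F has_derivative A) (at z) \<Longrightarrow> N (h - \<alpha> *\<^sub>R A h) \<le> k * N h"
  shows "N ((x - \<alpha> *\<^sub>R F x) - (y - \<alpha> *\<^sub>R F y)) \<le> k * N (x - y)"
proof -
  obtain L where L: "\<And>x y. norm (F x - F y) \<le> L * norm (x - y)"
    using lipschitz_wrt_imp_lipschitz[OF norm lip] by blast
  define G where "G x = x - \<alpha> *\<^sub>R F x" for x
  have "N (G (y + (x - y)) - G y) \<le> k * N (x - y)"
  proof (rule lipschitz_mean_value[OF norm])
    fix u v :: "real^'n"
    have "G u - G v = (u - v) - \<alpha> *\<^sub>R (F u - F v)" by (simp add: G_def algebra_simps)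
    then have "norm (G u - G v) \<le> norm (u - v) + \<alpha> * norm (F u - F v)"
      using norm_triangle_ineq4[of "u - v" "\<alpha> *\<^sub>R (F u - F v)"] \<alpha> by simp
    also have "\<dots> \<le> norm (u - v) + \<alpha> * (L * norm (u - v))"
      using \<alpha> L by (intro add_left_mono mult_left_mono) auto
    finally show "norm (G u - G v) \<le> (1 + \<alpha> * L) * norm (u - v)" by (simp add: algebra_simps)
  next
    fix z D assume "(G has_derivative D) (at z)"
    then have "(F has_derivative (\<lambda>h. (h - D h) /\<^sub>R \<alpha>)) (at z)"
      using \<alpha> by (intro derivative_diff_scaleR_imp) (auto simp: G_def[abs_def])
    from deriv[OF this, of "x - y"] show "N (D (x - y)) \<le> k * N (x - y)" using \<alpha> by simp
  qed
  then show ?thesis by (simp add: G_def)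
qed

text \<open>Expanding \<open>(I - t A)\<^sup>m\<close> in powers of \<open>A\<close>: the terms of order at least two are dominated by those
  of \<open>(1 + t l)\<^sup>m\<close>.\<close>

lemma linear_step_power_bounds:
  assumes A: "linear A" and Al: "\<And>h. N (A h) \<le> l * N h" and l: "l \<ge> 0" and t: "t \<ge> 0"
  defines "B \<equiv> \<lambda>h. h - t *\<^sub>R A h"
  shows "N ((B ^^ m) h - h) \<le> ((1 + t * l) ^ m - 1) * N h"
    and "N ((B ^^ m) h - h + (m * t) *\<^sub>R A h) \<le> ((1 + t * l) ^ m - 1 - m * t * l) * N h"
proof -
  have b: "N ((B ^^ m) h - h) \<le> ((1 + t * l) ^ m - 1) * N h" for m
  proof (induction m)
    case 0 then show ?case by (simp add: is_norm_zero[OF norm])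
  next
    case (Suc m)
    let ?u = "(B ^^ m) h"
    have "N ((B ^^ Suc m) h - h) = N ((?u - h) - t *\<^sub>R A ?u)" by (simp add: B_def algebra_simps)
    also have "\<dots> \<le> N (?u - h) + N (t *\<^sub>R A ?u)" by (rule is_norm_triangle_diff[OF norm])
    also have "N (t *\<^sub>R A ?u) = t * N (A ?u)" using t by (simp add: is_norm_scaleR[OF norm])
    also have "t * N (A ?u) \<le> t * (l * N ?u)" using t Al by (intro mult_left_mono)
    also have "t * (l * N ?u) \<le> t * (l * (N (?u - h) + N h))"
      using t l is_norm_triangle[OF norm, of "?u - h" h] by (intro mult_left_mono) auto
    also have "N (?u - h) + t * (l * (N (?u - h) + N h)) = (1 + t * l) * N (?u - h) + t * l * N h"
      by (simp add: algebra_simps)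
    also have "\<dots> \<le> (1 + t * l) * (((1 + t * l) ^ m - 1) * N h) + t * l * N h"
      using Suc t l by (intro add_right_mono mult_left_mono) auto
    also have "\<dots> = ((1 + t * l) ^ Suc m - 1) * N h" by (simp add: algebra_simps)
    finally show ?case by simp
  qed
  then show "N ((B ^^ m) h - h) \<le> ((1 + t * l) ^ m - 1) * N h" .
  show "N ((B ^^ m) h - h + (m * t) *\<^sub>R A h) \<le> ((1 + t * l) ^ m - 1 - m * t * l) * N h"
  proof (induction m)
    case 0 then show ?case by (simp add: is_norm_zero[OF norm])
  next
    case (Suc m)
    let ?u = "(B ^^ m) h"
    \<comment> \<open>The new second-order remainder is the old one minus \<open>t * A\<close>
      applied to the first-order deviation, which the first bound controls.\<close>
    have eq: "(B ^^ Suc m) h - h + (Suc m * t) *\<^sub>R A h = (?u - h + (m * t) *\<^sub>R A h) - t *\<^sub>R A (?u - h)"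
      by (simp add: B_def linear_diff[OF A] algebra_simps)
    have "N ((B ^^ Suc m) h - h + (Suc m * t) *\<^sub>R A h) \<le> N (?u - h + (m * t) *\<^sub>R A h) + t * N (A (?u - h))"
      unfolding eq using is_norm_triangle_diff[OF norm, of "?u - h + (m * t) *\<^sub>R A h" "t *\<^sub>R A (?u - h)"] t
      by (simp add: is_norm_scaleR[OF norm])
    also have "t * N (A (?u - h)) \<le> t * (l * N (?u - h))" using t Al by (intro mult_left_mono)
    also have "\<dots> \<le> t * (l * (((1 + t * l) ^ m - 1) * N h))" using t l b by (intro mult_left_mono)
    also have "N (?u - h + (m * t) *\<^sub>R A h) + t * (l * (((1 + t * l) ^ m - 1) * N h)) \<le>
        ((1 + t * l) ^ m - 1 - m * t * l) * N h + t * (l * (((1 + t * l) ^ m - 1) * N h))"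
      using Suc by simp
    also have "\<dots> = ((1 + t * l) ^ Suc m - 1 - Suc m * t * l) * N h" by (simp add: algebra_simps)
    finally show ?case by simp
  qed
qed

text \<open>Monotonicity controls only short steps well, so the long step is written as
  \<open>B ^^ m\<close> minus its terms of order at least two. The power inherits decay from the
  short steps; the remainder is paid for with the Lipschitz constant.\<close>

lemma forward_step_exp_bound:
  assumes lip: "lipschitz_wrt F N l" and mon: "monotone_param F N c" and \<alpha>: "\<alpha> > 0"
    and A: "(F has_derivative A) (at z)"
  shows "N (h - \<alpha> *\<^sub>R A h) \<le> (exp (- \<alpha> * c) + exp (\<alpha> * l) - 1 - \<alpha> * l) * N h"
proof -
  have c: "c \<ge> 0" using mon by (simp add: monotone_param_def)
  have l: "l \<ge> 0" by (rule lipschitz_wrt_nonneg[OF norm lip])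
  have Al: "N (A h) \<le> l * N h" for h by (rule lipschitz_wrt_derivative_bound[OF norm lip A])
  \<comment> \<open>The estimate after \<open>1 + u \<le> exp u\<close> has been applied to
    \<open>(1 + l\<^sup>2 * t\<^sup>2) ^ m\<close> with \<open>t = \<alpha> / m\<close>. The
    accumulated quadratic error is \<open>l\<^sup>2 * \<alpha>\<^sup>2 / m\<close> in the exponent
    and tends to 0.\<close>
  define E where "E m = exp (l\<^sup>2 * \<alpha>\<^sup>2 * inverse (real m)) / (1 + c * \<alpha> / real m) ^ m
      + ((1 + \<alpha> * l / real m) ^ m - 1 - \<alpha> * l)" for m
  have bound: "N (h - \<alpha> *\<^sub>R A h) \<le> E m * N h" if m: "m > 0" for m
  proof -
    define t where "t = \<alpha> / real m"
    have t: "t \<ge> 0" "real m * t = \<alpha>" using m \<alpha> by (auto simp: t_def)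
    define B where "B h = h - t *\<^sub>R A h" for h
    define \<rho> where "\<rho> = (1 + l\<^sup>2 * t\<^sup>2) / (1 + c * t)"
    have ct: "1 + c * t > 0" using c t by (simp add: add_pos_nonneg)
    have \<rho>: "\<rho> \<ge> 0" using ct by (simp add: \<rho>_def)
    have step: "N (B h) \<le> \<rho> * N h" for h
      using forward_step_derivative_bound[OF norm lip mon t(1) A, of h] ct
      by (simp add: \<rho>_def B_def field_simps)
    have pow: "N ((B ^^ m) h) \<le> \<rho> ^ m * N h" for m
    proof (induction m)
      case (Suc m)
      then show ?case using step[of "(B ^^ m) h"] mult_left_mono[OF Suc \<rho>] by (simp add: mult_ac)
    qed simp
    have Bdef: "B = (\<lambda>h. h - t *\<^sub>R A h)" by (simp add: B_def fun_eq_iff)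
    have "h - \<alpha> *\<^sub>R A h = (B ^^ m) h - ((B ^^ m) h - h + (real m * t) *\<^sub>R A h)" by (simp add: t)
    then have "N (h - \<alpha> *\<^sub>R A h) \<le> N ((B ^^ m) h) + N ((B ^^ m) h - h + (real m * t) *\<^sub>R A h)"
      using is_norm_triangle_diff[OF norm] by metis
    also have "\<dots> \<le> \<rho> ^ m * N h + ((1 + t * l) ^ m - 1 - real m * t * l) * N h"
      using pow linear_step_power_bounds(2)[OF has_derivative_linear[OF A] Al l t(1), of m h]
      unfolding Bdef by (intro add_mono) auto
    also have "\<dots> = (\<rho> ^ m + ((1 + t * l) ^ m - 1 - real m * t * l)) * N h" by (simp add: algebra_simps)
    also have "\<dots> \<le> E m * N h"
    proof (intro mult_right_mono is_norm_nonneg[OF norm])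
      have "(1 + l\<^sup>2 * t\<^sup>2) ^ m \<le> exp (l\<^sup>2 * t\<^sup>2) ^ m" by (intro power_mono exp_ge_add_one_self) auto
      also have "\<dots> = exp (real m * (l\<^sup>2 * t\<^sup>2))" by (simp add: exp_of_nat_mult)
      also have "real m * (l\<^sup>2 * t\<^sup>2) = l\<^sup>2 * \<alpha>\<^sup>2 * inverse (real m)"
        using m by (simp add: t_def power2_eq_square field_simps)
      finally have "\<rho> ^ m \<le> exp (l\<^sup>2 * \<alpha>\<^sup>2 * inverse (real m)) / (1 + c * t) ^ m"
        using ct by (simp add: \<rho>_def power_divide divide_right_mono)
      then show "\<rho> ^ m + ((1 + t * l) ^ m - 1 - real m * t * l) \<le> E m"
        unfolding E_def using t by (simp add: t_def)
    qed
    finally show ?thesis .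
  qed
  have "E \<longlonglongrightarrow> exp (l\<^sup>2 * \<alpha>\<^sup>2 * 0) / exp (c * \<alpha>) + (exp (\<alpha> * l) - 1 - \<alpha> * l)"
    unfolding E_def
    by (intro tendsto_intros tendsto_exp_limit_sequentially LIMSEQ_inverse_real_of_nat lim_inverse_n) auto
  also have "exp (l\<^sup>2 * \<alpha>\<^sup>2 * 0) / exp (c * \<alpha>) + (exp (\<alpha> * l) - 1 - \<alpha> * l) =
      exp (- \<alpha> * c) + exp (\<alpha> * l) - 1 - \<alpha> * l"
    by (simp add: exp_minus field_simps)
  finally have "(\<lambda>m. E m * N h) \<longlonglongrightarrow> (exp (- \<alpha> * c) + exp (\<alpha> * l) - 1 - \<alpha> * l) * N h"
    by (intro tendsto_intros)
  moreover have "\<exists>M. \<forall>m\<ge>M. N (h - \<alpha> *\<^sub>R A h) \<le> E m * N h" using bound by (intro exI[of _ 1]) auto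
  ultimately show ?thesis by (rule LIMSEQ_le_const)
qed

section \<open>Fixed point iterations in an arbitrary norm\<close>

lemma LIMSEQ_if_is_norm_LIMSEQ:
  assumes "(\<lambda>k. N (x k - y)) \<longlonglongrightarrow> 0"
  shows "x \<longlonglongrightarrow> y"
proof -
  obtain C where C: "\<And>x. norm x \<le> C * N x" using norm_le_is_norm[OF norm] by blast
  have "(\<lambda>k. C * N (x k - y)) \<longlonglongrightarrow> 0" using tendsto_mult[OF tendsto_const assms, of C] by simp
  then have "(\<lambda>k. norm (x k - y)) \<longlonglongrightarrow> 0"
    by (rule tendsto_sandwich[OF _ _ tendsto_const, rotated 2]) (auto simp: C)
  then show ?thesis by (simp only: tendsto_norm_zero_iff LIM_zero_iff)
qed

lemma continuous_if_is_norm_lipschitz: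
  fixes G :: "real^'n \<Rightarrow> real^'n"
  assumes "\<And>x y. N (G x - G y) \<le> k * N (x - y)"
  shows "continuous_on UNIV G"
proof -
  have "lipschitz_wrt G N k" using assms by (simp add: lipschitz_wrt_def)
  from lipschitz_wrt_imp_lipschitz[OF norm this] show ?thesis
    using lipschitz_continuous_on_UNIV by blast
qed

text \<open>Banach's fixed point theorem for \<open>N\<close>, which is not the norm of the type.
  The geometric decay in \<open>N\<close> is transferred to the Euclidean norm, where the increments
  become an absolutely summable series.\<close>

lemma contraction_iterates:
  fixes G :: "real^'n \<Rightarrow> real^'n"
  assumes con: "\<And>x y. N (G x - G y) \<le> k * N (x - y)" and k: "k < 1"
  shows "\<exists>xs. G xs = xs \<and> (\<forall>z. G z = z \<longrightarrow> z = xs) \<and> (\<lambda>m. (G ^^ m) x0) \<longlonglongrightarrow> xs \<and>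
    (\<forall>m. N ((G ^^ Suc m) x0 - xs) \<le> k * N ((G ^^ m) x0 - xs))"
proof -
  have k0: "k \<ge> 0" using lipschitz_wrt_nonneg[OF norm, of G k] con by (simp add: lipschitz_wrt_def)
  define x where "x m = (G ^^ m) x0" for m
  have xS: "x (Suc m) = G (x m)" for m by (simp add: x_def)
  have d: "N (x (Suc m) - x m) \<le> k ^ m * N (x 1 - x 0)" for m
  proof (induction m)
    case (Suc m)
    have "N (x (Suc (Suc m)) - x (Suc m)) \<le> k * N (x (Suc m) - x m)" using con by (simp add: xS)
    also have "\<dots> \<le> k * (k ^ m * N (x 1 - x 0))" using Suc k0 by (intro mult_left_mono)
    finally show ?case by simp
  qed simp
  obtain C where C: "C > 0" "\<And>x. norm x \<le> C * N x" using norm_le_is_norm[OF norm] by blast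
  have nd: "norm (x (Suc m) - x m) \<le> C * N (x 1 - x 0) * k ^ m" for m
  proof -
    have "norm (x (Suc m) - x m) \<le> C * N (x (Suc m) - x m)" by (rule C)
    also have "\<dots> \<le> C * (k ^ m * N (x 1 - x 0))" using d C by (intro mult_left_mono) auto
    finally show ?thesis by (simp add: mult_ac)
  qed
  have "summable (\<lambda>m. x (Suc m) - x m)"
  proof (rule summable_comparison_test)
    show "\<exists>M. \<forall>m\<ge>M. norm (x (Suc m) - x m) \<le> C * N (x 1 - x 0) * k ^ m" using nd by blast
    show "summable (\<lambda>m. C * N (x 1 - x 0) * k ^ m)"
      using k k0 by (intro summable_mult summable_geometric) auto
  qed
  then obtain s where "(\<lambda>m. \<Sum>i<m. x (Suc i) - x i) \<longlonglongrightarrow> s" unfolding summable_def sums_def by blast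
  then have "(\<lambda>m. x m - x 0 + x 0) \<longlonglongrightarrow> s + x 0"
    unfolding sum_lessThan_telescope by (intro tendsto_add tendsto_const)
  then obtain xs where xs: "x \<longlonglongrightarrow> xs" by auto
  have "isCont G xs"
    using continuous_if_is_norm_lipschitz[OF con] by (simp add: continuous_on_eq_continuous_at)
  then have "(\<lambda>m. G (x m)) \<longlonglongrightarrow> G xs" using xs by (rule isCont_tendsto_compose)
  moreover have "(\<lambda>m. x (Suc m)) \<longlonglongrightarrow> xs" using xs by (rule LIMSEQ_Suc)
  ultimately have fix': "G xs = xs" unfolding xS by (rule LIMSEQ_unique)
  have "z = xs" if "G z = z" for z
  proof (rule ccontr)
    assume "z \<noteq> xs"
    then have "N (z - xs) > 0" by (intro is_norm_pos[OF norm]) simp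
    moreover have "N (z - xs) \<le> k * N (z - xs)" using con[of z xs] that fix' by simp
    ultimately show False using k by (simp add: mult_le_cancel_right1)
  qed
  moreover have "N (x (Suc m) - xs) \<le> k * N (x m - xs)" for m using con[of "x m" xs] by (simp add: xS fix')
  ultimately show ?thesis using fix' xs unfolding x_def by blast
qed

text \<open>Goebel and Kirk's inequality for an averaged nonexpansive map, in the case where the displacement
  along the orbit is constant.\<close>

lemma averaged_constant_displacement:
  fixes T :: "real^'n \<Rightarrow> real^'n" and y :: "nat \<Rightarrow> real^'n"
  assumes T: "\<And>x y. N (T x - T y) \<le> N (x - y)" and \<theta>: "0 < \<theta>" "\<theta> < 1"
    and y: "\<And>m. y (Suc m) = (1 - \<theta>) *\<^sub>R y m + \<theta> *\<^sub>R T (y m)"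
    and \<rho>: "\<And>m. N (T (y m) - y m) = \<rho>"
  shows "(1 + real m * \<theta>) * \<rho> \<le> N (T (y (i + m)) - y i)"
proof (induction m arbitrary: i)
  case 0 then show ?case by (simp add: \<rho>)
next
  case (Suc m)
  have step: "N (y (Suc j) - y j) = \<theta> * \<rho>" for j
  proof -
    have "y (Suc j) - y j = \<theta> *\<^sub>R (T (y j) - y j)" by (simp add: y algebra_simps)
    then show ?thesis using \<theta> by (simp add: is_norm_scaleR[OF norm] \<rho>)
  qed
  have dist: "N (y (i + j) - y i) \<le> real j * (\<theta> * \<rho>)" for j
  proof (induction j)
    case 0 then show ?case by (simp add: is_norm_zero[OF norm])
  next
    case (Suc j)
    have "N (y (i + Suc j) - y i) \<le> N (y (i + Suc j) - y (i + j)) + N (y (i + j) - y i)"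
      by (rule is_norm_triangle_via[OF norm])
    then show ?case using Suc step[of "i + j"] by (simp add: algebra_simps)
  qed
  define X where "X = N (T (y (i + Suc m)) - y i)"
  let ?u = "T (y (i + Suc m))"
  \<comment> \<open>The induction hypothesis at the shifted start \<open>Suc i\<close> bounds the
    left side from below. The first part on the right is the wanted quantity, the second is small by
    nonexpansiveness. Solving uses \<open>1 + m * \<theta> - (m + 1) * \<theta>\<^sup>2 = (1 -
    \<theta>) * (1 + (m + 1) * \<theta>)\<close>.\<close>
  have "?u - y (Suc i) = (1 - \<theta>) *\<^sub>R (?u - y i) + \<theta> *\<^sub>R (?u - T (y i))" by (simp add: y algebra_simps)
  then have "N (?u - y (Suc i)) \<le> N ((1 - \<theta>) *\<^sub>R (?u - y i)) + N (\<theta> *\<^sub>R (?u - T (y i)))"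
    using is_norm_triangle[OF norm] by metis
  also have "\<dots> = (1 - \<theta>) * X + \<theta> * N (?u - T (y i))" using \<theta> by (simp add: is_norm_scaleR[OF norm] X_def)
  also have "\<dots> \<le> (1 - \<theta>) * X + \<theta> * (real (Suc m) * (\<theta> * \<rho>))"
    using \<theta> order_trans[OF T dist[of "Suc m"]] by (intro add_left_mono mult_left_mono) auto
  finally have "(1 + real m * \<theta>) * \<rho> \<le> (1 - \<theta>) * X + \<theta> * (real (Suc m) * (\<theta> * \<rho>))"
    using Suc[of "Suc i"] by simp
  then have "(1 - \<theta>) * ((1 + real (Suc m) * \<theta>) * \<rho>) \<le> (1 - \<theta>) * X" by (simp add: algebra_simps)
  then show ?case using \<theta> by (simp add: X_def)
qed

text \<open>The Krasnoselskii-Mann theorem. By compactness the orbit of a limit point has constant displacement, which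
  must vanish because orbits are bounded.\<close>

lemma averaged_iterates_converge:
  fixes T :: "real^'n \<Rightarrow> real^'n"
  assumes T: "\<And>x y. N (T x - T y) \<le> N (x - y)" and \<theta>: "0 < \<theta>" "\<theta> < 1" and p: "T p = p"
  defines "G \<equiv> \<lambda>x. (1 - \<theta>) *\<^sub>R x + \<theta> *\<^sub>R T x"
  shows "\<exists>xs. T xs = xs \<and> (\<lambda>m. (G ^^ m) x0) \<longlonglongrightarrow> xs"
proof -
  have Gne: "N (G u - G v) \<le> N (u - v)" for u v
  proof -
    have "G u - G v = (1 - \<theta>) *\<^sub>R (u - v) + \<theta> *\<^sub>R (T u - T v)" by (simp add: G_def algebra_simps)
    then have "N (G u - G v) \<le> N ((1 - \<theta>) *\<^sub>R (u - v)) + N (\<theta> *\<^sub>R (T u - T v))"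
      using is_norm_triangle[OF norm] by metis
    also have "\<dots> = (1 - \<theta>) * N (u - v) + \<theta> * N (T u - T v)" using \<theta> by (simp add: is_norm_scaleR[OF norm])
    also have "\<dots> \<le> (1 - \<theta>) * N (u - v) + \<theta> * N (u - v)" using \<theta> T by (intro add_left_mono mult_left_mono) auto
    finally show ?thesis by (simp add: algebra_simps)
  qed
  have Gp: "G q = q" if "T q = q" for q using that by (simp add: G_def algebra_simps)
  have contG: "continuous_on UNIV G" using continuous_if_is_norm_lipschitz[of G 1] Gne by simp
  have fejer: "N ((G ^^ m) u - q) \<le> N (u - q)" if "T q = q" for m u q
  proof (induction m)
    case (Suc m)
    then show ?case using Gne[of "(G ^^ m) u" q] Gp[OF that] by simp
  qed simp
  define x where "x m = (G ^^ m) x0" for m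
  have xS: "x (Suc m) = G (x m)" for m by (simp add: x_def)
  obtain C where C: "C > 0" "\<And>x. norm x \<le> C * N x" using norm_le_is_norm[OF norm] by blast
  have "bounded (range x)"
  proof (rule boundedI)
    fix u assume "u \<in> range x"
    then obtain m where u: "u = x m" by blast
    have "norm (x m) \<le> norm (x m - p) + norm p" using norm_triangle_ineq[of "x m - p" p] by simp
    also have "norm (x m - p) \<le> C * N (x m - p)" by (rule C)
    also have "\<dots> \<le> C * N (x0 - p)" using fejer[OF p] C by (intro mult_left_mono) (auto simp: x_def)
    finally show "norm u \<le> C * N (x0 - p) + norm p" by (simp add: u)
  qed
  then obtain y0 \<sigma> where \<sigma>: "strict_mono (\<sigma> :: nat \<Rightarrow> nat)" "(x \<circ> \<sigma>) \<longlonglongrightarrow> y0"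
    using bounded_imp_convergent_subsequence by blast
  define y where "y m = (G ^^ m) y0" for m
  have yS: "y (Suc m) = (1 - \<theta>) *\<^sub>R y m + \<theta> *\<^sub>R T (y m)" for m by (simp add: y_def G_def)
  \<comment> \<open>The orbit of the limit point is a limit of shifted pieces of the original
    orbit.\<close>
  have lim: "(\<lambda>j. x (m + \<sigma> j)) \<longlonglongrightarrow> y m" for m
  proof (induction m)
    case 0 then show ?case using \<sigma>(2) by (simp add: y_def o_def)
  next
    case (Suc m)
    have "isCont G (y m)" using contG by (simp add: continuous_on_eq_continuous_at)
    from isCont_tendsto_compose[OF this Suc] show ?case by (simp add: xS y_def)
  qed
  have "decseq (\<lambda>m. N (x (Suc m) - x m))"
    by (rule decseq_SucI) (use Gne in \<open>simp add: xS\<close>)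
  then obtain r where r: "(\<lambda>m. N (x (Suc m) - x m)) \<longlonglongrightarrow> r"
    using decseq_convergent[of "\<lambda>m. N (x (Suc m) - x m)" 0] is_norm_nonneg[OF norm] by metis
  \<comment> \<open>Displacements along \<open>x\<close> decrease to \<open>r\<close>, and shifting
    the index does not change this limit.\<close>
  have ry: "N (y (Suc m) - y m) = r" for m
  proof (rule LIMSEQ_unique)
    show "(\<lambda>j. N (x (Suc m + \<sigma> j) - x (m + \<sigma> j))) \<longlonglongrightarrow> N (y (Suc m) - y m)"
      by (intro tendsto_is_norm[OF norm] tendsto_diff lim)
    have "filterlim (\<lambda>j. m + \<sigma> j) at_top sequentially"
      using filterlim_subseq[OF \<sigma>(1)] by (rule filterlim_at_top_mono) auto
    from filterlim_compose[OF r this]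
    show "(\<lambda>j. N (x (Suc m + \<sigma> j) - x (m + \<sigma> j))) \<longlonglongrightarrow> r" by simp
  qed
  define \<rho> where "\<rho> = r / \<theta>"
  have \<rho>: "N (T (y m) - y m) = \<rho>" for m
  proof -
    have "y (Suc m) - y m = \<theta> *\<^sub>R (T (y m) - y m)" by (simp add: yS algebra_simps)
    then have "r = \<theta> * N (T (y m) - y m)" using ry[of m] \<theta> by (simp add: is_norm_scaleR[OF norm])
    then show ?thesis using \<theta> by (simp add: \<rho>_def)
  qed
  have bd: "(1 + real m * \<theta>) * \<rho> \<le> 2 * N (y0 - p)" for m
  proof -
    have "(1 + real m * \<theta>) * \<rho> \<le> N (T (y (0 + m)) - y 0)"
      by (rule averaged_constant_displacement[where T = T and y = y and \<rho> = \<rho>, OF T \<theta> yS \<rho>])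
    also have "\<dots> \<le> N (T (y m) - p) + N (p - y 0)" using is_norm_triangle_via[OF norm] by simp
    also have "N (p - y 0) = N (y0 - p)" using is_norm_minus_commute[OF norm, of p y0] by (simp add: y_def)
    also have "N (T (y m) - p) \<le> N (y0 - p)"
      using T[of "y m" p] fejer[OF p, of m y0] by (simp add: p y_def)
    finally show ?thesis by simp
  qed
  have "\<rho> = 0"
  proof (rule ccontr)
    assume "\<rho> \<noteq> 0"
    then have pos: "\<rho> > 0" using \<rho>[of 0] is_norm_nonneg[OF norm, of "T (y 0) - y 0"] by simp
    obtain m where "2 * N (y0 - p) / (\<theta> * \<rho>) < real m" using reals_Archimedean2 by blast
    then have "2 * N (y0 - p) < real m * \<theta> * \<rho>" using pos \<theta> by (simp add: field_simps)
    with bd[of m] pos show False by (simp add: algebra_simps)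
  qed
  then have fix': "T y0 = y0" using \<rho>[of 0] is_norm_eq_0[OF norm, of "T y0 - y0"] by (simp add: y_def)
  \<comment> \<open>Once \<open>y0\<close> is a fixed point, distances to it never increase, so
    convergence of the subsequence forces convergence of the whole orbit.\<close>
  have "decseq (\<lambda>m. N (x m - y0))"
    by (rule decseq_SucI) (use Gne[of _ y0] Gp[OF fix'] in \<open>simp add: xS\<close>)
  then obtain s where s: "(\<lambda>m. N (x m - y0)) \<longlonglongrightarrow> s"
    using decseq_convergent[of "\<lambda>m. N (x m - y0)" 0] is_norm_nonneg[OF norm] by metis
  have "(\<lambda>j. N (x (\<sigma> j) - y0)) \<longlonglongrightarrow> s"
    using filterlim_compose[OF s filterlim_subseq[OF \<sigma>(1)]] .
  moreover have "(\<lambda>j. N (x (\<sigma> j) - y0)) \<longlonglongrightarrow> N (y0 - y0)"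
    using \<sigma>(2) by (intro tendsto_is_norm[OF norm] tendsto_diff tendsto_const) (simp add: o_def)
  ultimately have "s = 0" using LIMSEQ_unique is_norm_zero[OF norm] by fastforce
  with s have "x \<longlonglongrightarrow> y0" by (intro LIMSEQ_if_is_norm_LIMSEQ) simp
  with fix' show ?thesis unfolding x_def by blast
qed

end

section \<open>The critical step size\<close>

text \<open>The function \<open>h\<close> vanishes at 0, has slope \<open>- c\<close> there and a
  strictly increasing derivative. It dips below 0 and can return to 0 only once: a value
  \<open>h a \<ge> 0\<close> before a zero \<open>b\<close> would require a nonnegative slope left
  of \<open>a\<close> and a nonpositive one right of \<open>a\<close>.\<close>

lemma critical_step_aux:
  fixes c l :: real
  assumes c: "c > 0" and l: "l > 0"
  defines "h \<equiv> \<lambda>a. exp (- a * c) + exp (a * l) - 2 - a * l"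
  shows "0 < a \<Longrightarrow> a < b \<Longrightarrow> h b = 0 \<Longrightarrow> h a < 0" and "\<exists>a>0. h a = 0"
proof -
  define h' where "h' a = - c * exp (- a * c) + l * exp (a * l) - l" for a
  have der: "(h has_real_derivative h' a) (at a)" for a
    unfolding h_def h'_def by (auto intro!: derivative_eq_intros)
  have h0: "h 0 = 0" by (simp add: h_def)
  have h'mono: "h' a < h' b" if "a < b" for a b
  proof -
    have "c * exp (- b * c) < c * exp (- a * c)" using that c by simp
    moreover have "l * exp (a * l) < l * exp (b * l)" using that l by simp
    ultimately show ?thesis by (simp add: h'_def)
  qed
  show "h a < 0" if ab: "0 < a" "a < b" "h b = 0"
  proof (rule ccontr)
    assume "\<not> h a < 0"
    then have ha: "h a \<ge> 0" by simp
    obtain u where u: "0 < u" "u < a" "h a - h 0 = (a - 0) * h' u" using MVT2[OF ab(1) der] by blast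
    obtain v where v: "a < v" "v < b" "h b - h a = (b - a) * h' v" using MVT2[OF ab(2) der] by blast
    have "h' u \<ge> 0" using u ha h0 ab by (simp add: zero_le_mult_iff)
    moreover have "(b - a) * h' v \<le> 0" using v ha ab by simp
    then have "h' v \<le> 0" using ab by (simp add: mult_le_0_iff)
    ultimately show False using h'mono[of u v] u v by simp
  qed
  have "h' 0 < 0" using c by (simp add: h'_def)
  from DERIV_neg_dec_right[OF der this] obtain d where d: "d > 0" "\<And>x. 0 < x \<Longrightarrow> x < d \<Longrightarrow> h x < 0"
    using h0 by auto
  \<comment> \<open>Half of \<open>d\<close> gives a negative value of \<open>h\<close>; the cap
    \<open>1 / l\<close> places \<open>a\<close> to the left of \<open>2 / l\<close>.\<close>
  define a where "a = min (d / 2) (1 / l)"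
  have a: "0 < a" "a < d" "a \<le> 2 / l" using d l by (auto simp: a_def min_def field_simps)
  \<comment> \<open>At \<open>2 / l\<close> the part without \<open>c\<close> is
    \<open>exp 2 - 4\<close>, already positive.\<close>
  have "h (2 / l) \<ge> 0"
  proof -
    have "exp (2::real) \<ge> 5" using exp_lower_Taylor_quadratic[of 2] by simp
    moreover have "h (2 / l) = exp (- (2 / l) * c) + exp 2 - 4" using l by (simp add: h_def)
    moreover have "exp (- (2 / l) * c) > 0" by (rule exp_gt_zero)
    ultimately show ?thesis by linarith
  qed
  moreover have "isCont h x" for x using der by (rule DERIV_isCont)
  ultimately obtain x where "a \<le> x" "h x = 0"
    using IVT[of h a 0 "2 / l"] d(2)[OF a(1,2)] a by (metis less_imp_le)
  then show "\<exists>a>0. h a = 0" using a by (intro exI[of _ x]) auto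
qed

section \<open>Diagonally weighted norms\<close>

text \<open>Comparison of the coefficients of \<open>t\<close>: it is
  \<open>c * p + \<sigma>\<close> on the left and 0 on the right, and small \<open>t\<close> makes
  the quadratic terms irrelevant.\<close>

lemma le_neg_mult_if_quadratic_bound:
  fixes c l p \<sigma> :: real
  assumes "\<And>t. t > 0 \<Longrightarrow> (1 + c * t) * (p + t * \<sigma>) \<le> (1 + l\<^sup>2 * t\<^sup>2) * p"
  shows "\<sigma> \<le> - c * p"
proof (rule ccontr)
  assume "\<not> \<sigma> \<le> - c * p"
  then have a: "c * p + \<sigma> > 0" by simp
  define b where "b = l\<^sup>2 * p - c * \<sigma>"
  \<comment> \<open>Chosen so that \<open>t * (\<bar>b\<bar> + 1)\<close> is half of
    \<open>c * p + \<sigma>\<close>; the added 1 covers \<open>b = 0\<close>.\<close>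
  define t where "t = (c * p + \<sigma>) / (2 * (\<bar>b\<bar> + 1))"
  have t: "t > 0" using a by (simp add: t_def)
  from assms[OF t] have "t * (c * p + \<sigma>) \<le> t * (t * b)" by (simp add: b_def power2_eq_square algebra_simps)
  then have "c * p + \<sigma> \<le> t * b" using t by simp
  also have "\<dots> \<le> t * (\<bar>b\<bar> + 1)" using t by (intro mult_left_mono) auto
  also have "\<dots> = (c * p + \<sigma>) / 2"
    using abs_ge_zero[of b] unfolding t_def by (simp add: divide_simps del: abs_ge_zero)
  finally show False using a by simp
qed

lemma linear_axis_expansion:
  fixes A :: "real^'n \<Rightarrow> real^'n"
  assumes "linear A"
  shows "A h = (\<Sum>j\<in>UNIV. h $ j *\<^sub>R A (axis j 1))"
proof -
  have "A h = A (\<Sum>j\<in>UNIV. h $ j *\<^sub>R axis j 1)" using basis_expansion[of h] by (simp add: scalar_mult_eq_scaleR)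
  also have "\<dots> = (\<Sum>j\<in>UNIV. h $ j *\<^sub>R A (axis j 1))" using assms by (simp add: linear_sum linear_scale)
  finally show ?thesis .
qed

text \<open>A weighted column sum of \<open>I - t A\<close> is
  \<open>\<eta> $ j + t * \<sigma> j\<close> as soon as \<open>1 - t * a j j \<ge> 0\<close>, and at
  least that in general. The bound for small \<open>t\<close> therefore determines
  \<open>\<sigma> j\<close>, a logarithmic norm of a column of \<open>- A\<close>, and the same
  affine expression remains exact up to \<alpha>. Columns suffice because the norm is additive over
  coordinates.\<close>

lemma wl1_norm_linear_step:
  fixes A :: "real^'n \<Rightarrow> real^'n"
  assumes norm: "is_norm (wl1_norm \<eta>)" and \<eta>: "\<And>i. \<eta> $ i > 0" and A: "linear A"
    and bound: "\<And>t h. t > 0 \<Longrightarrow> (1 + c * t) * wl1_norm \<eta> (h - t *\<^sub>R A h) \<le> (1 + l\<^sup>2 * t\<^sup>2) * wl1_norm \<eta> h"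
    and c: "c \<ge> 0" and \<alpha>: "\<alpha> > 0" and diag: "\<And>i. \<alpha> * A (axis i 1) $ i \<le> 1"
  shows "wl1_norm \<eta> (h - \<alpha> *\<^sub>R A h) \<le> (1 - \<alpha> * c) * wl1_norm \<eta> h"
proof -
  let ?N = "wl1_norm \<eta>"
  define a where "a i j = A (axis j 1) $ i" for i j
  define \<sigma> where "\<sigma> j = (\<Sum>i\<in>UNIV - {j}. \<eta> $ i * \<bar>a i j\<bar>) - \<eta> $ j * a j j" for j
  have col: "?N (axis j 1 - t *\<^sub>R A (axis j 1)) = \<eta> $ j * \<bar>1 - t * a j j\<bar> + t * (\<Sum>i\<in>UNIV - {j}. \<eta> $ i * \<bar>a i j\<bar>)"
    if t: "t > 0" for t j
  proof -
    have "?N (axis j 1 - t *\<^sub>R A (axis j 1)) = \<eta> $ j * \<bar>1 - t * a j j\<bar> +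
        (\<Sum>i\<in>UNIV - {j}. \<eta> $ i * \<bar>(axis j 1 - t *\<^sub>R A (axis j 1)) $ i\<bar>)"
      unfolding wl1_norm_def by (subst sum.remove[of UNIV j]) (auto simp: a_def axis_def)
    also have "(\<Sum>i\<in>UNIV - {j}. \<eta> $ i * \<bar>(axis j 1 - t *\<^sub>R A (axis j 1)) $ i\<bar>) =
        (\<Sum>i\<in>UNIV - {j}. t * (\<eta> $ i * \<bar>a i j\<bar>))"
      by (intro sum.cong refl) (use t in \<open>auto simp: a_def axis_def abs_mult\<close>)
    finally show ?thesis by (simp add: sum_distrib_left)
  qed
  have axis: "?N (axis j 1) = \<eta> $ j" for j
    unfolding wl1_norm_def by (subst sum.remove[of UNIV j]) (auto simp: axis_def)
  have \<sigma>: "\<sigma> j \<le> - c * \<eta> $ j" for j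
  proof (rule le_neg_mult_if_quadratic_bound)
    fix t :: real assume t: "t > 0"
    have "\<eta> $ j * (1 - t * a j j) \<le> \<eta> $ j * \<bar>1 - t * a j j\<bar>" using \<eta>[of j] by (intro mult_left_mono) auto
    then have "\<eta> $ j + t * \<sigma> j \<le> ?N (axis j 1 - t *\<^sub>R A (axis j 1))"
      unfolding col[OF t] by (simp add: \<sigma>_def algebra_simps)
    then have "(1 + c * t) * (\<eta> $ j + t * \<sigma> j) \<le> (1 + c * t) * ?N (axis j 1 - t *\<^sub>R A (axis j 1))"
      using c t by (intro mult_left_mono) auto
    also have "\<dots> \<le> (1 + l\<^sup>2 * t\<^sup>2) * \<eta> $ j" using bound[OF t, of "axis j 1"] by (simp add: axis)
    finally show "(1 + c * t) * (\<eta> $ j + t * \<sigma> j) \<le> (1 + l\<^sup>2 * t\<^sup>2) * \<eta> $ j" .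
  qed
  have colb: "?N (axis j 1 - \<alpha> *\<^sub>R A (axis j 1)) \<le> (1 - \<alpha> * c) * \<eta> $ j" for j
  proof -
    have "\<bar>1 - \<alpha> * a j j\<bar> = 1 - \<alpha> * a j j" using diag[of j] by (simp add: a_def)
    then have "?N (axis j 1 - \<alpha> *\<^sub>R A (axis j 1)) = \<eta> $ j + \<alpha> * \<sigma> j"
      unfolding col[OF \<alpha>] by (simp add: \<sigma>_def algebra_simps)
    also have "\<dots> \<le> \<eta> $ j + \<alpha> * (- c * \<eta> $ j)" using \<sigma> \<alpha> by (intro add_left_mono mult_left_mono) auto
    finally show ?thesis by (simp add: algebra_simps)
  qed
  have "(\<lambda>h. h - \<alpha> *\<^sub>R A h) h = (\<Sum>j\<in>UNIV. h $ j *\<^sub>R (axis j 1 - \<alpha> *\<^sub>R A (axis j 1)))"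
    by (rule linear_axis_expansion) (intro linear_compose_sub linear_compose_scale_right linear_ident A)
  then have eq: "h - \<alpha> *\<^sub>R A h = (\<Sum>j\<in>UNIV. h $ j *\<^sub>R (axis j 1 - \<alpha> *\<^sub>R A (axis j 1)))" .
  have "?N (h - \<alpha> *\<^sub>R A h) \<le> (\<Sum>j\<in>UNIV. ?N (h $ j *\<^sub>R (axis j 1 - \<alpha> *\<^sub>R A (axis j 1))))"
    unfolding eq by (rule is_norm_sum[OF norm])
  also have "\<dots> = (\<Sum>j\<in>UNIV. \<bar>h $ j\<bar> * ?N (axis j 1 - \<alpha> *\<^sub>R A (axis j 1)))"
    by (simp only: is_norm_scaleR[OF norm])
  also have "\<dots> \<le> (\<Sum>j\<in>UNIV. \<bar>h $ j\<bar> * ((1 - \<alpha> * c) * \<eta> $ j))"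
    by (intro sum_mono mult_left_mono colb) auto
  also have "\<dots> = (1 - \<alpha> * c) * ?N h" by (simp add: wl1_norm_def sum_distrib_left mult_ac)
  finally show ?thesis .
qed

lemma wlinf_norm_le_iff:
  fixes \<eta> x :: "real^'n"
  assumes \<eta>: "\<And>i. \<eta> $ i > 0"
  shows "wlinf_norm \<eta> x \<le> k \<longleftrightarrow> (\<forall>i. \<bar>x $ i\<bar> \<le> k * \<eta> $ i)"
  unfolding wlinf_norm_def using \<eta> by (subst Max_le_iff) (auto simp: pos_divide_le_eq)

text \<open>The row version of the previous argument. A row sum is not the norm of the image of a
  coordinate vector, so a test vector adapted to row \<open>i\<close> has to extract
  \<sigma>.\<close>

lemma wlinf_norm_linear_step:
  fixes A :: "real^'n \<Rightarrow> real^'n"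
  assumes \<eta>: "\<And>i. \<eta> $ i > 0" and A: "linear A"
    and bound: "\<And>t h. t > 0 \<Longrightarrow> (1 + c * t) * wlinf_norm \<eta> (h - t *\<^sub>R A h) \<le> (1 + l\<^sup>2 * t\<^sup>2) * wlinf_norm \<eta> h"
    and c: "c \<ge> 0" and \<alpha>: "\<alpha> > 0" and diag: "\<And>i. \<alpha> * A (axis i 1) $ i \<le> 1"
  shows "wlinf_norm \<eta> (h - \<alpha> *\<^sub>R A h) \<le> (1 - \<alpha> * c) * wlinf_norm \<eta> h"
  unfolding wlinf_norm_le_iff[OF \<eta>]
proof
  fix i :: 'n
  let ?N = "wlinf_norm \<eta>"
  have le: "\<bar>x $ j\<bar> \<le> ?N x * \<eta> $ j" for x j using wlinf_norm_le_iff[OF \<eta>, of x "?N x"] by blast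
  define a where "a j = A (axis j 1) $ i" for j
  define \<sigma> where "\<sigma> = (\<Sum>j\<in>UNIV - {i}. \<bar>a j\<bar> * \<eta> $ j) - a i * \<eta> $ i"
  have comp: "A g $ i = a i * g $ i + (\<Sum>j\<in>UNIV - {i}. a j * g $ j)" for g
    using sum.remove[of UNIV i "\<lambda>j. a j * g $ j"]
    by (subst linear_axis_expansion[OF A]) (simp add: a_def mult.commute)
  \<comment> \<open>The signs make every off-diagonal entry of row \<open>i\<close> contribute
    \<open>\<bar>a j\<bar> * \<eta> $ j\<close> with the same sign to \<open>- A g\<close>, while
    all coordinates stay within the weights.\<close>
  define g :: "real^'n" where "g = (\<chi> j. \<eta> $ j * (if j = i then 1 else - sgn (a j)))"
  have "?N g \<le> 1" unfolding wlinf_norm_le_iff[OF \<eta>]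
    using \<eta> by (auto simp: g_def abs_mult abs_sgn_eq less_imp_le)
  have \<sigma>: "\<sigma> \<le> - c * \<eta> $ i"
  proof (rule le_neg_mult_if_quadratic_bound)
    fix t :: real assume t: "t > 0"
    have "(\<Sum>j\<in>UNIV - {i}. a j * g $ j) = (\<Sum>j\<in>UNIV - {i}. - (\<bar>a j\<bar> * \<eta> $ j))"
      by (intro sum.cong refl) (auto simp: g_def abs_sgn)
    then have "(g - t *\<^sub>R A g) $ i = \<eta> $ i + t * \<sigma>"
      by (simp add: comp g_def \<sigma>_def sum_negf algebra_simps)
    then have "(1 + c * t) * (\<eta> $ i + t * \<sigma>) \<le> (1 + c * t) * (?N (g - t *\<^sub>R A g) * \<eta> $ i)"
      using le[of "g - t *\<^sub>R A g" i] c t by (intro mult_left_mono) auto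
    also have "\<dots> \<le> ((1 + l\<^sup>2 * t\<^sup>2) * ?N g) * \<eta> $ i"
      using mult_right_mono[OF bound[OF t, of g], of "\<eta> $ i"] \<eta>[of i] by (simp add: mult_ac)
    also have "\<dots> \<le> ((1 + l\<^sup>2 * t\<^sup>2) * 1) * \<eta> $ i"
      using \<open>?N g \<le> 1\<close> \<eta>[of i] by (intro mult_right_mono mult_left_mono) (auto simp: add_nonneg_nonneg)
    finally show "(1 + c * t) * (\<eta> $ i + t * \<sigma>) \<le> (1 + l\<^sup>2 * t\<^sup>2) * \<eta> $ i" by simp
  qed
  have ai: "0 \<le> 1 - \<alpha> * a i" using diag[of i] by (simp add: a_def)
  have N0: "?N h \<ge> 0"
  proof -
    have "0 \<le> ?N h * \<eta> $ i" using le[of h i] abs_ge_zero order_trans by blast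
    then show ?thesis using \<eta>[of i] by (simp add: zero_le_mult_iff)
  qed
  have "(h - \<alpha> *\<^sub>R A h) $ i = (1 - \<alpha> * a i) * h $ i - \<alpha> * (\<Sum>j\<in>UNIV - {i}. a j * h $ j)"
    by (simp add: comp algebra_simps)
  then have "\<bar>(h - \<alpha> *\<^sub>R A h) $ i\<bar> \<le> (1 - \<alpha> * a i) * \<bar>h $ i\<bar> + \<alpha> * \<bar>\<Sum>j\<in>UNIV - {i}. a j * h $ j\<bar>"
    using abs_triangle_ineq4[of "(1 - \<alpha> * a i) * h $ i" "\<alpha> * (\<Sum>j\<in>UNIV - {i}. a j * h $ j)"] ai \<alpha>
    by (simp add: abs_mult)
  also have "\<bar>\<Sum>j\<in>UNIV - {i}. a j * h $ j\<bar> \<le> (\<Sum>j\<in>UNIV - {i}. \<bar>a j * h $ j\<bar>)" by (rule sum_abs)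
  also have "(\<Sum>j\<in>UNIV - {i}. \<bar>a j * h $ j\<bar>) \<le> (\<Sum>j\<in>UNIV - {i}. ?N h * (\<bar>a j\<bar> * \<eta> $ j))"
  proof (rule sum_mono)
    fix j
    show "\<bar>a j * h $ j\<bar> \<le> ?N h * (\<bar>a j\<bar> * \<eta> $ j)"
      using mult_left_mono[OF le[of h j], of "\<bar>a j\<bar>"] by (simp add: abs_mult mult_ac)
  qed
  also have "\<dots> = ?N h * (\<Sum>j\<in>UNIV - {i}. \<bar>a j\<bar> * \<eta> $ j)" by (rule sum_distrib_left[symmetric])
  also have "(1 - \<alpha> * a i) * \<bar>h $ i\<bar> \<le> (1 - \<alpha> * a i) * (?N h * \<eta> $ i)" using le ai by (intro mult_left_mono)
  also have "(1 - \<alpha> * a i) * (?N h * \<eta> $ i) + \<alpha> * (?N h * (\<Sum>j\<in>UNIV - {i}. \<bar>a j\<bar> * \<eta> $ j)) =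
      ?N h * (\<eta> $ i + \<alpha> * \<sigma>)"
    by (simp add: \<sigma>_def algebra_simps)
  also have "\<dots> \<le> ?N h * (\<eta> $ i + \<alpha> * (- c * \<eta> $ i))"
    using \<sigma> \<alpha> N0 by (intro mult_left_mono add_left_mono) auto
  finally show "\<bar>(h - \<alpha> *\<^sub>R A h) $ i\<bar> \<le> (1 - \<alpha> * c) * ?N h * \<eta> $ i" using \<alpha> by (simp add: algebra_simps)
qed

lemma diag_weighted_linear_step:
  assumes norm: "is_norm N" and dw: "diag_weighted_l1_or_linf N"
    and lip: "lipschitz_wrt F N l" and mon: "monotone_param F N c"
    and A: "(F has_derivative A) (at z)" and \<alpha>: "\<alpha> > 0" and diag: "\<And>i. \<alpha> * A (axis i 1) $ i \<le> 1"
  shows "N (h - \<alpha> *\<^sub>R A h) \<le> (1 - \<alpha> * c) * N h"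
proof -
  have c: "c \<ge> 0" using mon by (simp add: monotone_param_def)
  have bound: "(1 + c * t) * N (h - t *\<^sub>R A h) \<le> (1 + l\<^sup>2 * t\<^sup>2) * N h" if "t > 0" for t h
    using that by (intro forward_step_derivative_bound[OF norm lip mon _ A]) simp
  obtain \<eta> where \<eta>: "\<And>i. \<eta> $ i > 0" "N = wl1_norm \<eta> \<or> N = wlinf_norm \<eta>"
    using dw unfolding diag_weighted_l1_or_linf_def by blast
  from \<eta>(2) show ?thesis
  proof
    assume N: "N = wl1_norm \<eta>"
    show ?thesis unfolding N
      by (rule wl1_norm_linear_step[OF norm[unfolded N] \<eta>(1) has_derivative_linear[OF A] bound[unfolded N] c \<alpha> diag])
  next
    assume N: "N = wlinf_norm \<eta>"
    show ?thesis unfolding N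
      by (rule wlinf_norm_linear_step[OF \<eta>(1) has_derivative_linear[OF A] bound[unfolded N] c \<alpha> diag])
  qed
qed

text \<open>For a short enough step the column of \<open>axis i 1\<close> contracts by
  \<open>1 - \<alpha> * c\<close>, and its diagonal entry alone accounts for
  \<open>\<bar>1 - \<alpha> * A (axis i 1) $ i\<bar>\<close>.\<close>

lemma diagonal_ge_monotone_param:
  assumes norm: "is_norm N" and dw: "diag_weighted_l1_or_linf N"
    and lip: "lipschitz_wrt F N l" and mon: "monotone_param F N c"
    and A: "(F has_derivative A) (at z)"
  shows "c \<le> A (axis i 1) $ i"
proof -
  define M where "M = Max (range (\<lambda>i. A (axis i 1) $ i))"
  have M: "A (axis i 1) $ i \<le> M" for i unfolding M_def by (intro Max_ge) auto
  define \<alpha> where "\<alpha> = 1 / (\<bar>M\<bar> + 1)"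
  have \<alpha>: "\<alpha> > 0" by (simp add: \<alpha>_def)
  have diag: "\<alpha> * A (axis j 1) $ j \<le> 1" for j using M[of j] by (simp add: \<alpha>_def field_simps)
  have le: "N (axis i 1 - \<alpha> *\<^sub>R A (axis i 1)) \<le> (1 - \<alpha> * c) * N (axis i 1)"
    by (rule diag_weighted_linear_step[OF norm dw lip mon A \<alpha> diag])
  obtain \<eta> where \<eta>: "\<And>i. \<eta> $ i > 0" "N = wl1_norm \<eta> \<or> N = wlinf_norm \<eta>"
    using dw unfolding diag_weighted_l1_or_linf_def by blast
  \<comment> \<open>The weight \<open>w\<close> is \<open>\<eta> $ i\<close> for the first norm and
    \<open>1 / \<eta> $ i\<close> for the second.\<close>
  have "\<exists>w>0. N (axis i 1) = w \<and> (\<forall>x. w * \<bar>x $ i\<bar> \<le> N x)"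
  proof (cases "N = wl1_norm \<eta>")
    case True
    have "N (axis i 1) = \<eta> $ i"
      unfolding True wl1_norm_def by (subst sum.remove[of UNIV i]) (auto simp: axis_def)
    moreover have "\<eta> $ i * \<bar>x $ i\<bar> \<le> N x" for x
      unfolding True wl1_norm_def using \<eta>(1) by (intro member_le_sum) (auto simp: less_imp_le)
    ultimately show ?thesis using \<eta>(1) by blast
  next
    case False
    then have N: "N = wlinf_norm \<eta>" using \<eta>(2) by simp
    have le': "\<bar>x $ i\<bar> / \<eta> $ i \<le> N x" for x
      unfolding N wlinf_norm_def by (intro Max_ge) auto
    have "N (axis i 1) \<le> 1 / \<eta> $ i"
      unfolding N wlinf_norm_le_iff[OF \<eta>(1)] using \<eta>(1) less_imp_neq[OF \<eta>(1)[of i]]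
      by (auto simp: axis_def less_imp_le)
    moreover have "1 / \<eta> $ i \<le> N (axis i 1)" using le'[of "axis i 1"] by (simp add: axis_def)
    ultimately have "N (axis i 1) = 1 / \<eta> $ i" by simp
    with le' \<eta>(1)[of i] show ?thesis by (intro exI[of _ "1 / \<eta> $ i"]) auto
  qed
  then obtain w where w: "w > 0" "N (axis i 1) = w" "\<And>x. w * \<bar>x $ i\<bar> \<le> N x" by blast
  have "w * \<bar>1 - \<alpha> * A (axis i 1) $ i\<bar> \<le> (1 - \<alpha> * c) * w"
    using order_trans[OF w(3) le] by (simp add: w(2))
  then have "\<bar>1 - \<alpha> * A (axis i 1) $ i\<bar> \<le> 1 - \<alpha> * c" using w(1) by (simp add: mult.commute)
  then have "\<alpha> * c \<le> \<alpha> * A (axis i 1) $ i" by simp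
  then show ?thesis using \<alpha> by simp
qed

text \<open>A real supremum dominates its members only if the set is bounded above; Lipschitz
  continuity and norm equivalence provide a bound on all diagonal entries.\<close>

lemma diagonal_le_diagL:
  fixes F :: "real^'n \<Rightarrow> real^'n"
  assumes norm: "is_norm N" and lip: "lipschitz_wrt F N l" and A: "(F has_derivative A) (at z)"
  shows "A (axis i 1) $ i \<le> diagL F"
proof -
  obtain B where B: "B > 0" "\<And>x. N x \<le> B * norm x" using is_norm_le_norm[OF norm] by blast
  obtain C where C: "C > 0" "\<And>x. norm x \<le> C * N x" using norm_le_is_norm[OF norm] by blast
  have l: "l \<ge> 0" by (rule lipschitz_wrt_nonneg[OF norm lip])
  let ?d = "\<lambda>x. Max (range (\<lambda>i. (frechet_derivative F (at x) (axis i 1)) $ i))"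
  have bd: "D (axis j 1) $ j \<le> C * (l * B)" if D: "(F has_derivative D) (at x)" for D x j
  proof -
    have "D (axis j 1) $ j \<le> norm (D (axis j 1))" using component_le_norm_cart[of "D (axis j 1)" j] by simp
    also have "\<dots> \<le> C * N (D (axis j 1))" by (rule C)
    also have "\<dots> \<le> C * (l * N (axis j 1))"
      using lipschitz_wrt_derivative_bound[OF norm lip D] C by (intro mult_left_mono) auto
    also have "\<dots> \<le> C * (l * B)" using B(2)[of "axis j 1"] C l by (intro mult_left_mono) auto
    finally show ?thesis .
  qed
  have bdd: "bdd_above (?d ` {x. F differentiable (at x)})"
  proof (rule bdd_aboveI2)
    fix x assume "x \<in> {x. F differentiable (at x)}"
    then have "(F has_derivative frechet_derivative F (at x)) (at x)" by (simp add: frechet_derivative_works)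
    from bd[OF this] show "?d x \<le> C * (l * B)" by (subst Max_le_iff) auto
  qed
  have z: "z \<in> {x. F differentiable (at x)}" using A by (auto simp: differentiable_def)
  have "A (axis i 1) $ i \<le> ?d z"
    unfolding frechet_derivative_at[OF A, symmetric] by (intro Max_ge) auto
  also have "\<dots> \<le> diagL F" unfolding diagL_def by (rule cSUP_upper[OF z bdd])
  finally show ?thesis .
qed

text \<open>With \<open>c > 0\<close> this is the contraction of (ii), with \<open>c = 0\<close> the
  nonexpansiveness behind (iii).\<close>

lemma diag_weighted_forward_step_lipschitz:
  assumes norm: "is_norm N" and dw: "diag_weighted_l1_or_linf N"
    and lip: "lipschitz_wrt F N l" and mon: "monotone_param F N c"
    and \<alpha>: "\<alpha> > 0" "\<alpha> * diagL F \<le> 1"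
  shows "N ((x - \<alpha> *\<^sub>R F x) - (y - \<alpha> *\<^sub>R F y)) \<le> (1 - \<alpha> * c) * N (x - y)"
proof (rule forward_step_lipschitz[OF norm lip \<alpha>(1)])
  fix z A h assume A: "(F has_derivative A) (at z)"
  have "\<alpha> * A (axis i 1) $ i \<le> 1" for i
    using order_trans[OF mult_left_mono[OF diagonal_le_diagL[OF norm lip A, of i], of \<alpha>] \<alpha>(2)] \<alpha>(1) by simp
  then show "N (h - \<alpha> *\<^sub>R A h) \<le> (1 - \<alpha> * c) * N h"
    by (rule diag_weighted_linear_step[OF norm dw lip mon A \<alpha>(1)])
qed

text \<open>Ensures for \<open>c > 0\<close> that \<open>1 / diagL F\<close> is a genuine positive
  step. One point of differentiability is enough, and Rademacher's theorem supplies it.\<close>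

lemma monotone_param_le_diagL:
  fixes F :: "real^'n \<Rightarrow> real^'n"
  assumes norm: "is_norm N" and dw: "diag_weighted_l1_or_linf N"
    and lip: "lipschitz_wrt F N l" and mon: "monotone_param F N c"
  shows "c \<le> diagL F"
proof -
  obtain L where L: "\<And>x y. norm (F x - F y) \<le> L * norm (x - y)"
    using lipschitz_wrt_imp_lipschitz[OF norm lip] by blast
  obtain Z where Z: "Z \<in> null_sets lborel" "\<And>z. z \<notin> Z \<Longrightarrow> F differentiable (at z)"
    using AE_lborel_imp_null_set[OF rademacher[OF L]] by blast
  have "Z \<noteq> UNIV" using Z(1) by (auto simp: null_sets_def)
  then obtain z where "F differentiable (at z)" using Z(2) by blast
  then obtain A where "(F has_derivative A) (at z)" unfolding differentiable_def by blast
  then show ?thesis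
    using diagonal_ge_monotone_param[OF norm dw lip mon] diagonal_le_diagL[OF norm lip] order_trans by blast
qed

text \<open>With \<open>l = 0\<close> the equation for the critical step would reduce to
  \<open>exp (- a * c) = 1\<close>, without a positive solution. But then \<open>F\<close> is
  constant, and the pair bound at \<open>t = 1\<close> says
  \<open>(1 + c) * N v \<le> N v\<close>.\<close>

lemma monotone_param_pos_imp_lipschitz_pos:
  fixes F :: "real^'n \<Rightarrow> real^'n"
  assumes norm: "is_norm N" and lip: "lipschitz_wrt F N l" and mon: "monotone_param F N c" and c: "c > 0"
  shows "l > 0"
proof (rule ccontr)
  assume "\<not> l > 0"
  then have l: "l = 0" using lipschitz_wrt_nonneg[OF norm lip] by simp
  define v :: "real^'n" where "v = axis undefined 1"
  have "v \<noteq> 0" by (simp add: v_def axis_eq_0_iff)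
  then have Nv: "N v > 0" by (rule is_norm_pos[OF norm])
  have "N (F v - F 0) \<le> 0" using lip l by (simp add: lipschitz_wrt_def)
  then have "F v - F 0 = 0" using is_norm_nonneg[OF norm, of "F v - F 0"] is_norm_eq_0[OF norm] by simp
  then have "(1 + c) * N v \<le> N v" using forward_step_pair_bound[OF norm lip mon, of 1 v 0] l by simp
  then show False using Nv c by simp
qed

lemma forward_step_contraction_iterates:
  assumes norm: "is_norm N" and \<alpha>: "\<alpha> > 0" and k: "k < 1"
    and con: "\<And>x y. N ((x - \<alpha> *\<^sub>R F x) - (y - \<alpha> *\<^sub>R F y)) \<le> k * N (x - y)"
  shows "\<exists>xs. F xs = 0 \<and> (\<forall>z. F z = 0 \<longrightarrow> z = xs) \<and> fwd_iter F \<alpha> x0 \<longlonglongrightarrow> xs \<and>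
    (\<forall>m. N (fwd_iter F \<alpha> x0 (Suc m) - xs) \<le> k * N (fwd_iter F \<alpha> x0 m - xs))"
proof -
  have "fwd_iter F \<alpha> x0 = (\<lambda>m. ((\<lambda>x. x - \<alpha> *\<^sub>R F x) ^^ m) x0)" by (simp add: fwd_iter_def fun_eq_iff)
  moreover have "x - \<alpha> *\<^sub>R F x = x \<longleftrightarrow> F x = 0" for x using \<alpha> by simp
  ultimately show ?thesis
    using contraction_iterates[of N "\<lambda>x. x - \<alpha> *\<^sub>R F x" k x0, OF norm con k] by (simp only:)
qed

text \<open>Strictness of \<open>\<alpha> * diagL F < 1\<close> leaves room for a longer step
  \<beta> that is still nonexpansive. The step with \<alpha> is then the average of the identity and
  the step with \<beta>, with weight \<open>\<theta> = \<alpha> / \<beta>\<close>.\<close>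

lemma diag_weighted_monotone_iterates:
  assumes norm: "is_norm N" and dw: "diag_weighted_l1_or_linf N"
    and lip: "lipschitz_wrt F N l" and mon: "monotone_param F N 0"
    and p: "F p = 0" and \<alpha>: "\<alpha> > 0" "\<alpha> * diagL F < 1"
  shows "\<exists>xs. F xs = 0 \<and> fwd_iter F \<alpha> x0 \<longlonglongrightarrow> xs"
proof -
  \<comment> \<open>If \<open>diagL F\<close> is not positive, every longer step is admissible, and
    \<open>2 * \<alpha>\<close> will do.\<close>
  obtain \<beta> where \<beta>: "\<alpha> < \<beta>" "\<beta> * diagL F \<le> 1"
  proof (cases "diagL F > 0")
    case True
    then show ?thesis using that[of "1 / diagL F"] \<alpha> by (simp add: field_simps)
  next
    case False
    then have "2 * \<alpha> * diagL F \<le> 0" using \<alpha> by (simp add: mult_nonneg_nonpos)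
    then show ?thesis using that[of "2 * \<alpha>"] \<alpha> by simp
  qed
  define \<theta> where "\<theta> = \<alpha> / \<beta>"
  have \<theta>: "0 < \<theta>" "\<theta> < 1" "\<theta> * \<beta> = \<alpha>" using \<alpha> \<beta> by (auto simp: \<theta>_def)
  define T where "T x = x - \<beta> *\<^sub>R F x" for x
  have "N (T x - T y) \<le> N (x - y)" for x y
    using diag_weighted_forward_step_lipschitz[OF norm dw lip mon _ \<beta>(2), of x y] \<alpha> \<beta> by (simp add: T_def)
  moreover have "T p = p" by (simp add: T_def p)
  ultimately obtain xs where xs: "T xs = xs"
    "(\<lambda>m. ((\<lambda>x. (1 - \<theta>) *\<^sub>R x + \<theta> *\<^sub>R T x) ^^ m) x0) \<longlonglongrightarrow> xs"
    using averaged_iterates_converge[OF norm _ \<theta>(1,2)] by blast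
  have "(1 - \<theta>) *\<^sub>R x + \<theta> *\<^sub>R T x = x - \<alpha> *\<^sub>R F x" for x
    by (simp add: T_def algebra_simps flip: \<theta>(3))
  then have "fwd_iter F \<alpha> x0 \<longlonglongrightarrow> xs" using xs(2) by (simp add: fwd_iter_def[abs_def])
  moreover have "F xs = 0" using xs(1) \<alpha> \<beta> by (simp add: T_def)
  ultimately show ?thesis by blast
qed

theorem theorem26:
  fixes N :: "real^'n \<Rightarrow> real" and F :: "real^'n \<Rightarrow> real^'n" and l :: real and x0 :: "real^'n"
  assumes norm: "is_norm N"
    and lip: "lipschitz_wrt F N l"
  shows
   "(\<forall>c. c > 0 \<and> monotone_param F N c \<longrightarrow>
       (\<exists>!a. a > 0 \<and> exp (- a * c) + exp (a * l) = 2 + a * l) \<and>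
       (\<forall>astar \<alpha>. astar > 0 \<and> exp (- astar * c) + exp (astar * l) = 2 + astar * l \<and>
                  0 < \<alpha> \<and> \<alpha> < astar \<longrightarrow>
          (\<exists>xs. F xs = 0 \<and> (\<forall>z. F z = 0 \<longrightarrow> z = xs) \<and>
                fwd_iter F \<alpha> x0 \<longlonglongrightarrow> xs \<and>
                (\<forall>k. N (fwd_iter F \<alpha> x0 (Suc k) - xs)
                      \<le> (exp (- \<alpha> * c) + exp (\<alpha> * l) - 1 - \<alpha> * l) * N (fwd_iter F \<alpha> x0 k - xs)))))
    \<and>
    (\<forall>c. diag_weighted_l1_or_linf N \<and> c > 0 \<and> monotone_param F N c \<longrightarrow>
       (\<forall>\<alpha>. 0 < \<alpha> \<and> \<alpha> * diagL F \<le> 1 \<longrightarrow>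
          (\<exists>xs. F xs = 0 \<and> (\<forall>z. F z = 0 \<longrightarrow> z = xs) \<and>
                fwd_iter F \<alpha> x0 \<longlonglongrightarrow> xs \<and>
                (\<forall>k. N (fwd_iter F \<alpha> x0 (Suc k) - xs) \<le> (1 - \<alpha> * c) * N (fwd_iter F \<alpha> x0 k - xs))))
       \<and> (0 < 1 / diagL F \<and> (1 / diagL F) * diagL F \<le> 1 \<and>
          (\<forall>\<alpha>. 0 < \<alpha> \<and> \<alpha> * diagL F \<le> 1 \<longrightarrow> 1 - (1 / diagL F) * c \<le> 1 - \<alpha> * c)))
    \<and>
    (diag_weighted_l1_or_linf N \<and> monotone_param F N 0 \<and> {x. F x = 0} \<noteq> {} \<longrightarrow>
       (\<forall>\<alpha>. 0 < \<alpha> \<and> \<alpha> * diagL F < 1 \<longrightarrow>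
          (\<exists>xs. F xs = 0 \<and> fwd_iter F \<alpha> x0 \<longlonglongrightarrow> xs)))"
proof (intro conjI allI impI, goal_cases)
  case (1 c)
  then have l: "l > 0" using monotone_param_pos_imp_lipschitz_pos[OF norm lip] by blast
  from 1 have c: "c > 0" by blast
  obtain a where a: "a > 0" "exp (- a * c) + exp (a * l) - 2 - a * l = 0"
    using critical_step_aux(2)[OF c l] by blast
  show ?case
  proof (rule ex1I[of _ a])
    show "a > 0 \<and> exp (- a * c) + exp (a * l) = 2 + a * l" using a by simp
    fix b assume b: "b > 0 \<and> exp (- b * c) + exp (b * l) = 2 + b * l"
    show "b = a"
    proof (rule linorder_cases[of b a])
      assume "b < a"
      then show ?thesis using critical_step_aux(1)[OF c l, of b a] a b by simp
    next
      assume "a < b"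
      then show ?thesis using critical_step_aux(1)[OF c l, of a b] a b by simp
    qed
  qed
next
  case (2 c astar \<alpha>)
  then have c: "c > 0" and mon: "monotone_param F N c" and \<alpha>: "\<alpha> > 0" by blast+
  have l: "l > 0" using monotone_param_pos_imp_lipschitz_pos[OF norm lip mon c] .
  have "exp (- \<alpha> * c) + exp (\<alpha> * l) - 2 - \<alpha> * l < 0"
    using 2 by (intro critical_step_aux(1)[OF c l, of \<alpha> astar]) auto
  then have "exp (- \<alpha> * c) + exp (\<alpha> * l) - 1 - \<alpha> * l < 1" by simp
  then show ?case
    by (rule forward_step_contraction_iterates[OF norm \<alpha>])
      (rule forward_step_lipschitz[OF norm lip \<alpha>], rule forward_step_exp_bound[OF norm lip mon \<alpha>])
next
  case (3 c \<alpha>)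
  then have dw: "diag_weighted_l1_or_linf N" and c: "c > 0" and mon: "monotone_param F N c"
    and \<alpha>: "\<alpha> > 0" "\<alpha> * diagL F \<le> 1" by blast+
  have "1 - \<alpha> * c < 1" using \<alpha> c by simp
  then show ?case
    by (rule forward_step_contraction_iterates[OF norm \<alpha>(1)])
      (rule diag_weighted_forward_step_lipschitz[OF norm dw lip mon \<alpha>])
next
  \<comment> \<open>This goal and the next two concern the optimal step: \<open>1 / diagL F\<close>
    is positive, admissible, and gives the smallest factor.\<close>
  case (4 c)
  then have "0 < diagL F" using monotone_param_le_diagL[OF norm _ lip, of c] by simp
  then show ?case by simp
next
  case (5 c)
  then show ?case by simp
next
  case (6 c \<alpha>)
  then have "0 < diagL F" using monotone_param_le_diagL[OF norm _ lip, of c] by simp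
  then have "\<alpha> \<le> 1 / diagL F" using 6 by (simp add: field_simps)
  then have "\<alpha> * c \<le> 1 / diagL F * c" using 6 by (intro mult_right_mono) auto
  then show ?case by simp
next
  case (7 \<alpha>)
  then show ?case using diag_weighted_monotone_iterates[OF norm _ lip] by blast
qed

end
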